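(* Consider the plant $x(k+1)=f(x(k),u(k))$, $k\in\mathbb{N}_0$. Suppose that Assumptions 1, 2 and 3 (listed in the context) hold and that $\Omega<1$, where $$\Omega = \alpha\sum_{j\in\mathbb{N}}\mathbf{Pr}\{\Delta_i=j\}\,\rho^{j-1}$$ and $\{\Delta_i\}$ are the (i.i.d.) times between consecutive instants at which the buffer is out of calculated control values, as defined in the context. Then the plant state trajectory when controlled with Algorithm A$_1$ is stochastically stable, with the bound $$\sum_{k=0}^{\infty}\mathbf{E}\{\varphi_1(|x(k)|)\}< \frac{1+\alpha-\rho}{(1-\Omega)(1-\rho)}\,\mathbf{E}\{\varphi_2(|x(0)|)\}.$$
   Context: Notation: $\mathbb{N}=\{1,2,\dots\}$, $\mathbb{N}_0=\mathbb{N}\cup\{0\}$, $\mathbb{N}_n^m=\{n,\dots,m\}$; $|\cdot|$ is the Euclidean norm; $\mathbf{0}_p$ is the zero vector of $\mathbb{R}^p$; $0^0=1$. A function $\varphi:\mathbb{R}_{\ge0}\to\mathbb{R}_{\ge0}$ is of class $\mathscr{K}_\infty$ if it is continuous, zero at zero, strictly increasing and unbounded. $\Lambda\ge 2$ is a fixed integer (buffer length). Plant: $x(k)\in\mathbb{R}^n$, $u(k)\in\mathbb{R}^p$, $f(\mathbf{0}_n,\mathbf{0}_p)=\mathbf{0}_n$. The initial state $x(0)$ is arbitrary (subject to the moment condition in Assumption 3). Assumption 1: there exist $V:\mathbb{R}^n\to\mathbb{R}_{\ge0}$, $\varphi_1,\varphi_2\in\mathscr{K}_\infty$, a constant $\rho\in[0,1)$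 and a control policy $\kappa:\mathbb{R}^n\to\mathbb{R}^p$ such that for all $x\in\mathbb{R}^n$: $\varphi_1(|x|)\le V(x)\le\varphi_2(|x|)$ and $V(f(x,\kappa(x)))\le\rho V(x)$. Assumption 2: $\{N(k)\}_{k\in\mathbb{N}_0}$, with values in $\mathbb{N}_0^\Lambda$, is a homogeneous Markov chain with $N(0)=0$ and irreducible aperiodic transition matrix $\mathcal{Q}=[q_{ij}]_{i,j\in\mathbb{N}_0^\Lambda}$, $q_{ij}=\mathbf{Pr}\{N(k+1)=j\mid N(k)=i\}$. ($N(k)$ is the number of control values the processor calculates at time $k$.) Assumption 3: there exists $\alpha\in\mathbb{R}_{\ge0}$ such that $V(f(x,\mathbf{0}_p))\le\alpha V(x)$ for all $x\in\mathbb{R}^n$, and $\mathbf{E}\{\varphi_2(|x(0)|)\}<\infty$. Algorithm A$_1$: a buffer $b(k)=(b_1(k),\dots,b_\Lambda(k))$, $b_j(k)\in\mathbb{R}^p$, is maintained, with $b(-1)=0$. At time $k$: if $N(k)=0$, then $b_j(k)=b_{j+1}(k-1)$ for $j\in\mathbb{N}_1^{\Lambda-1}$ and $b_\Lambda(k)=\mathbf{0}_p$. If $N(k)\ge1$, set $\chi_1=x(k)$ and, for $j=1,\dots,N(k)$, $u_j(k)=\kappa(\chi_j)$, $\chi_{j+1}=f(\chi_j,u_j(k))$; then $b_j(k)=u_j(k)$ for $j\le N(k)$ and $b_j(k)=\mathbf{0}_p$ for $j>N(k)$. The plant input is $u(k)=b_1(k)$. Effective buffer length: $\lambda(-1)=0$;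 $\lambda(k)=N(k)$ if $N(k)\ge1$ and $\lambda(k)=\max(\lambda(k-1)-1,0)$ if $N(k)=0$. Times at which the buffer is out of calculated values: $k_0=0$, $k_{i+1}=\inf\{k\in\mathbb{N}: k>k_i,\ (N(k),\lambda(k))=(0,0)\}$ (equivalently $\lambda(k)=0$), and $\Delta_i=k_{i+1}-k_i$, $i\in\mathbb{N}_0$. The $\Delta_i$ are i.i.d., so $\mathbf{Pr}\{\Delta_i=j\}$ does not depend on $i$. Stochastic stability: a dynamical system with state trajectory $\{x(k)\}$ is stochastically stable if $\sum_{k=0}^\infty\mathbf{E}\{\varphi(|x(k)|)\}<\infty$ for some $\varphi\in\mathscr{K}_\infty$.
   Formalization: x(0) is assumed independent of the process {N(k)} (otherwise the bound can fail); the strict inequality is claimed only when Ω>0 and E{φ2(|x(0)|)}>0, with ≤ in the remaining cases (e.g. x(0)=0 or α=0), where strictness can fail. *)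

theory Defs
  imports "HOL-Probability.Probability"
begin

definition class_K_infinity :: "(real \<Rightarrow> real) \<Rightarrow> bool" where
  "class_K_infinity \<phi> \<longleftrightarrow>
     continuous_on {0..} \<phi> \<and> \<phi> 0 = 0 \<and> strict_mono_on {0..} \<phi> \<and> \<not> bdd_above (\<phi> ` {0..})"

(* Expectations of nonnegative quantities are Lebesgue integrals with values in ennreal,
   so that finiteness is a genuine assertion. *)
definition expect_norm ::
    "'w measure \<Rightarrow> (real \<Rightarrow> real) \<Rightarrow> ('w \<Rightarrow> 'a::real_normed_vector) \<Rightarrow> ennreal" where
  "expect_norm M \<phi> X = (\<integral>\<^sup>+ \<omega>. ennreal (\<phi> (norm (X \<omega>))) \<partial>M)"

definition stochastically_stable ::
    "'w measure \<Rightarrow> (nat \<Rightarrow> 'w \<Rightarrow> 'a::real_normed_vector) \<Rightarrow> bool" where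
  "stochastically_stable M x \<longleftrightarrow>
     (\<exists>\<phi>. class_K_infinity \<phi> \<and> (\<Sum>k. expect_norm M \<phi> (x k)) < \<infinity>)"

definition stochastic_matrix :: "nat set \<Rightarrow> (nat \<Rightarrow> nat \<Rightarrow> real) \<Rightarrow> bool" where
  "stochastic_matrix S Q \<longleftrightarrow> (\<forall>i\<in>S. \<forall>j\<in>S. 0 \<le> Q i j) \<and> (\<forall>i\<in>S. (\<Sum>j\<in>S. Q i j) = 1)"

primrec matrix_pow :: "nat set \<Rightarrow> (nat \<Rightarrow> nat \<Rightarrow> real) \<Rightarrow> nat \<Rightarrow> nat \<Rightarrow> nat \<Rightarrow> real" where
  "matrix_pow S Q 0 i j = (if i = j then 1 else 0)"
| "matrix_pow S Q (Suc n) i j = (\<Sum>l\<in>S. Q i l * matrix_pow S Q n l j)"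

definition irreducible_matrix :: "nat set \<Rightarrow> (nat \<Rightarrow> nat \<Rightarrow> real) \<Rightarrow> bool" where
  "irreducible_matrix S Q \<longleftrightarrow> (\<forall>i\<in>S. \<forall>j\<in>S. \<exists>n. 0 < matrix_pow S Q n i j)"

definition aperiodic_matrix :: "nat set \<Rightarrow> (nat \<Rightarrow> nat \<Rightarrow> real) \<Rightarrow> bool" where
  "aperiodic_matrix S Q \<longleftrightarrow> (\<forall>i\<in>S. Gcd {n. 1 \<le> n \<and> 0 < matrix_pow S Q n i i} = (1::nat))"

(* The guard restricts the Markov property to histories h of positive probability, where the
   conditional probability is meaningful. *)
definition homogeneous_markov_chain ::
    "'w measure \<Rightarrow> nat set \<Rightarrow> (nat \<Rightarrow> nat \<Rightarrow> real) \<Rightarrow> (nat \<Rightarrow> 'w \<Rightarrow> nat) \<Rightarrow> bool" where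
  "homogeneous_markov_chain M S Q N \<longleftrightarrow>
     (\<forall>k. N k \<in> measurable M (count_space S)) \<and> stochastic_matrix S Q \<and>
     (\<forall>k h. \<forall>j\<in>S. \<P>(\<omega> in M. \<forall>m\<le>k. N m \<omega> = h m) > 0 \<longrightarrow>
        \<P>(\<omega> in M. N (Suc k) \<omega> = j \<bar> \<forall>m\<le>k. N m \<omega> = h m) = Q (h k) j)"

(* Independence of the random variable X and the process N, as independence of the generated
   sigma-algebras. (The library's indep_var needs both sides to have the same value type.) *)
definition indep_of_process ::
    "'w measure \<Rightarrow> ('w \<Rightarrow> 'a::topological_space) \<Rightarrow> (nat \<Rightarrow> 'w \<Rightarrow> nat) \<Rightarrow> bool" where
  "indep_of_process M X N \<longleftrightarrow>
     prob_space.indep_set M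
       (sets (vimage_algebra (space M) X borel))
       (sets (vimage_algebra (space M) (\<lambda>\<omega> k. N k \<omega>) (Pi\<^sub>M UNIV (\<lambda>_. count_space UNIV))))"

(* chi_j for j = 1, 2, ..., with chi_1 = x and chi_{j+1} = f(chi_j, kappa(chi_j)) *)
definition predicted_state ::
    "('x \<Rightarrow> 'u \<Rightarrow> 'x) \<Rightarrow> ('x \<Rightarrow> 'u) \<Rightarrow> 'x \<Rightarrow> nat \<Rightarrow> 'x" where
  "predicted_state f \<kappa> x j = ((\<lambda>z. f z (\<kappa> z)) ^^ (j - 1)) x"

(* Buffer contents are functions of the slot j; only the slots 1, ..., L are meaningful. *)
definition buffer_step ::
    "nat \<Rightarrow> ('x \<Rightarrow> 'u \<Rightarrow> 'x) \<Rightarrow> ('x \<Rightarrow> 'u) \<Rightarrow> nat \<Rightarrow> 'x \<Rightarrow> (nat \<Rightarrow> 'u) \<Rightarrow> nat \<Rightarrow> 'u::zero" where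
  "buffer_step L f \<kappa> n x b j =
     (if n = 0 then (if j < L then b (j + 1) else 0)
      else (if j \<le> n then \<kappa> (predicted_state f \<kappa> x j) else 0))"

(* The buffer at time k, given the sample paths n of calculated control counts and x of plant
   states; the buffer at time -1 is zero. *)
primrec buffer ::
    "nat \<Rightarrow> ('x \<Rightarrow> 'u \<Rightarrow> 'x) \<Rightarrow> ('x \<Rightarrow> 'u) \<Rightarrow> (nat \<Rightarrow> nat) \<Rightarrow> (nat \<Rightarrow> 'x) \<Rightarrow> nat \<Rightarrow> nat \<Rightarrow> 'u::zero"
where
  "buffer L f \<kappa> n x 0 = buffer_step L f \<kappa> (n 0) (x 0) (\<lambda>_. 0)"
| "buffer L f \<kappa> n x (Suc k) = buffer_step L f \<kappa> (n (Suc k)) (x (Suc k)) (buffer L f \<kappa> n x k)"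

definition eff_length_step :: "nat \<Rightarrow> nat \<Rightarrow> nat" where
  "eff_length_step n l = (if 1 \<le> n then n else l - 1)"

(* lambda(k) along the path n, with lambda(-1) = 0; truncated subtraction gives the max with 0 *)
primrec eff_length :: "(nat \<Rightarrow> nat) \<Rightarrow> nat \<Rightarrow> nat" where
  "eff_length n 0 = eff_length_step (n 0) 0"
| "eff_length n (Suc k) = eff_length_step (n (Suc k)) (eff_length n k)"

(* k_i, which is infinite if the buffer does not run out of calculated values i times *)
primrec empty_time :: "(nat \<Rightarrow> nat) \<Rightarrow> nat \<Rightarrow> enat" where
  "empty_time n 0 = 0"
| "empty_time n (Suc i) =
     Inf {enat k | k. empty_time n i < enat k \<and> (n k, eff_length n k) = (0, 0)}"

(* Delta_i; note that infinity - infinity = infinity in enat *)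
definition empty_gap :: "(nat \<Rightarrow> nat) \<Rightarrow> nat \<Rightarrow> enat" where
  "empty_gap n i = empty_time n (Suc i) - empty_time n i"

definition Omega ::
    "'w measure \<Rightarrow> (nat \<Rightarrow> 'w \<Rightarrow> nat) \<Rightarrow> real \<Rightarrow> real \<Rightarrow> nat \<Rightarrow> real" where
  "Omega M N \<alpha> \<rho> i =
     \<alpha> * (\<Sum>\<^sub>\<infinity>j\<in>{1..}. \<P>(\<omega> in M. empty_gap (\<lambda>k. N k \<omega>) i = enat j) * \<rho> ^ (j - 1))"

end

theory Submission
  imports Defs
begin

text \<open>
  The input computed by the algorithm equals \<open>\<kappa> (x k)\<close> as long as the buffer still holds a calculated
  value, and is zero otherwise. Hence \<open>V\<close> is multiplied by at most \<open>\<rho>\<close> at times with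
  \<open>\<lambda>(k) > 0\<close> and by at most \<open>\<alpha>\<close> at times with \<open>\<lambda>(k) = 0\<close>, so that \<open>V (x k) \<le> G k * V (x 0)\<close> where the
  gain \<open>G k\<close> is the product of these factors (lemma \<open>lyapunov_gain\<close>). The gain depends on the process \<open>N\<close>
  alone, which is independent of \<open>x 0\<close>; everything reduces to computing the sum of the numbers \<open>E (G k)\<close>
  (lemma \<open>mean_gain_sums\<close>).

  At an instant with \<open>\<lambda>(k) = 0\<close> also \<open>N(k) = 0\<close>, so the chain and the buffer restart exactly as at time 0.
  Let \<open>a k\<close> be the mean of \<open>G k\<close> restricted to \<open>\<lambda>(k) = 0\<close> and \<open>c j\<close> the probability that the first
  return of \<open>\<lambda>\<close> to 0 takes \<open>j\<close> steps. A cycle of length \<open>j\<close> contributes the factor \<open>\<alpha> * \<rho>^(j-1)\<close>, whence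
  the renewal equation \<open>a (k+1) = (\<Sum>m\<le>k. a m * \<alpha> * \<rho>^(k-m) * c (k+1-m))\<close>. Summing it over \<open>k\<close> gives
  \<open>\<Sum>a = 1 / (1 - \<Omega>)\<close>. The one-step recursion \<open>E (G (k+1)) = \<rho> * E (G k) + (\<alpha> - \<rho>) * a k\<close> then gives
  \<open>(1 + \<alpha> - \<rho> - \<Omega>) / ((1 - \<Omega>) * (1 - \<rho>))\<close> for the sum of the mean gains. This is smaller than the
  stated constant by a term proportional to \<open>\<Omega>\<close>, which is why the inequality is strict when \<open>\<Omega> > 0\<close>
  and the initial moment is positive.

  It remains to see that \<open>\<Delta>_i\<close> has the same distribution \<open>c\<close> for every \<open>i\<close> (lemma \<open>empty_gap_prob\<close>).
  By regeneration, \<open>Pr(\<Delta>_i = j)\<close> is \<open>c j\<close> times the probability that \<open>k_i\<close> is finite. If \<open>c\<close> vanishes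
  identically, there is nothing to do: this can happen for an irreducible aperiodic chain, when \<open>N\<close> never
  leaves the buffer time to run empty. Otherwise the empty buffer is recurrent (lemma \<open>recurrence\<close>), because
  from every state there is a path of positive probability that empties the buffer, and the state space is
  finite; then all \<open>k_i\<close> are almost surely finite.
\<close>

section \<open>Functions of finitely many coordinates\<close>

definition determined_by :: "nat \<Rightarrow> ((nat \<Rightarrow> nat) \<Rightarrow> 'b) \<Rightarrow> bool" where
  "determined_by k F \<longleftrightarrow> (\<forall>n n'. (\<forall>m\<le>k. n m = n' m) \<longrightarrow> F n = F n')"

lemma determined_byI: "(\<And>n n'. (\<And>m. m \<le> k \<Longrightarrow> n m = n' m) \<Longrightarrow> F n = F n') \<Longrightarrow> determined_by k F"
  unfolding determined_by_def by blast

lemma determined_byD: "determined_by k F \<Longrightarrow> (\<And>m. m \<le> k \<Longrightarrow> n m = n' m) \<Longrightarrow> F n = F n'"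
  unfolding determined_by_def by blast

lemma determined_by_mono: "determined_by k F \<Longrightarrow> k \<le> l \<Longrightarrow> determined_by l F"
  unfolding determined_by_def by (meson order_trans)

lemma determined_by_const: "determined_by k (\<lambda>_. c)"
  unfolding determined_by_def by simp

lemma determined_by_comp: "determined_by k F \<Longrightarrow> determined_by k (\<lambda>n. g (F n))"
  unfolding determined_by_def by metis

lemma determined_by_comp2:
  "determined_by k F \<Longrightarrow> determined_by k G \<Longrightarrow> determined_by k (\<lambda>n. g (F n) (G n))"
  unfolding determined_by_def by metis

lemma determined_by_coord: "m \<le> k \<Longrightarrow> determined_by k (\<lambda>n. g (n m))"
  unfolding determined_by_def by simp

lemma determined_by_shift:
  "determined_by j G \<Longrightarrow> k + j \<le> l \<Longrightarrow> determined_by l (\<lambda>n. G (\<lambda>m. n (k + m)))"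
  unfolding determined_by_def by simp

section \<open>Means along a finite Markov chain\<close>

locale finite_markov_chain = prob_space M
  for M :: "'w measure" +
  fixes S :: "nat set" and Q :: "nat \<Rightarrow> nat \<Rightarrow> real" and N :: "nat \<Rightarrow> 'w \<Rightarrow> nat"
  assumes finite_S: "finite S"
    and chain: "homogeneous_markov_chain M S Q N"
begin

abbreviation path :: "'w \<Rightarrow> nat \<Rightarrow> nat" where
  "path \<omega> \<equiv> \<lambda>k. N k \<omega>"

definition cylinder :: "nat \<Rightarrow> (nat \<Rightarrow> nat) \<Rightarrow> 'w set" where
  "cylinder k h = {\<omega> \<in> space M. \<forall>m\<le>k. N m \<omega> = h m}"

definition path_mean :: "((nat \<Rightarrow> nat) \<Rightarrow> real) \<Rightarrow> real" where
  "path_mean F = expectation (\<lambda>\<omega>. F (path \<omega>))"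

lemma N_measurable: "N k \<in> measurable M (count_space S)"
  using chain unfolding homogeneous_markov_chain_def by blast

lemma N_measurable_UNIV [measurable]: "N k \<in> measurable M (count_space UNIV)"
  using N_measurable[of k] by (rule measurable_compose) simp

lemma N_in_S: "\<omega> \<in> space M \<Longrightarrow> N k \<omega> \<in> S"
  using measurable_space[OF N_measurable[of k]] by simp

lemma Q_nonneg: "i \<in> S \<Longrightarrow> j \<in> S \<Longrightarrow> 0 \<le> Q i j"
  using chain unfolding homogeneous_markov_chain_def stochastic_matrix_def by blast

lemma cylinder_sets [measurable]: "cylinder k h \<in> events"
  unfolding cylinder_def by measurable

lemma integrable_indicator: "B \<in> events \<Longrightarrow> integrable M (indicator B :: 'w \<Rightarrow> real)"
  by (rule integrable_real_indicator) (simp_all add: less_top[symmetric])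

lemma finite_histories: "finite (PiE {..k::nat} (\<lambda>_. S))"
  by (intro finite_PiE) (simp_all add: finite_S)

text \<open>
  Finitely many histories of length \<open>k + 1\<close> exist, so a function of the first \<open>k + 1\<close> coordinates is a
  finite combination of cylinder indicators. This makes every such function bounded and measurable and turns
  its mean into a finite sum, with no recourse to a path space.
\<close>

lemma sum_histories:
  fixes F :: "(nat \<Rightarrow> nat) \<Rightarrow> real"
  assumes F: "determined_by k F" and n: "\<And>m. m \<le> k \<Longrightarrow> n m \<in> S"
  shows "F n = (\<Sum>h\<in>PiE {..k} (\<lambda>_. S). F h * of_bool (\<forall>m\<le>k. n m = h m))"
proof -
  define h0 where "h0 = restrict n {..k}"
  have h0: "h0 \<in> PiE {..k} (\<lambda>_. S)" using n by (auto simp: h0_def)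
  have "(\<Sum>h\<in>PiE {..k} (\<lambda>_. S). F h * of_bool (\<forall>m\<le>k. n m = h m))
     = (\<Sum>h\<in>PiE {..k} (\<lambda>_. S). if h = h0 then F h0 else 0)"
  proof (rule sum.cong[OF refl])
    fix h assume h: "h \<in> PiE {..k} (\<lambda>_. S)"
    have "(\<forall>m\<le>k. n m = h m) \<longleftrightarrow> h = h0"
    proof
      assume e: "\<forall>m\<le>k. n m = h m"
      show "h = h0" using h h0 by (rule PiE_ext) (use e in \<open>auto simp: h0_def\<close>)
    qed (simp add: h0_def)
    then show "F h * of_bool (\<forall>m\<le>k. n m = h m) = (if h = h0 then F h0 else 0)" by simp
  qed
  also have "\<dots> = F h0" using h0 finite_histories by simp
  also have "\<dots> = F n" using F by (rule determined_byD) (simp add: h0_def)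
  finally show ?thesis by simp
qed

lemma path_determined:
  fixes F :: "(nat \<Rightarrow> nat) \<Rightarrow> real"
  assumes "determined_by k F" "\<omega> \<in> space M"
  shows "F (path \<omega>) = (\<Sum>h\<in>PiE {..k} (\<lambda>_. S). F h * indicator (cylinder k h) \<omega>)"
  using sum_histories[OF assms(1), of "path \<omega>"] assms(2)
  by (simp add: N_in_S cylinder_def indicator_def of_bool_def)

lemma measurable_determined:
  fixes F :: "(nat \<Rightarrow> nat) \<Rightarrow> real"
  assumes "determined_by k F"
  shows "(\<lambda>\<omega>. F (path \<omega>)) \<in> borel_measurable M"
  by (subst measurable_cong[OF path_determined[OF assms]]) simp_all

lemma integrable_determined:
  fixes F :: "(nat \<Rightarrow> nat) \<Rightarrow> real"
  assumes "determined_by k F"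
  shows "integrable M (\<lambda>\<omega>. F (path \<omega>))"
  by (subst Bochner_Integration.integrable_cong[OF refl path_determined[OF assms]], assumption)
    (intro Bochner_Integration.integrable_sum integrable_mult_right integrable_indicator cylinder_sets)

lemma mean_indicator:
  assumes F: "determined_by k F" and B: "B \<in> events"
  shows "expectation (\<lambda>\<omega>. F (path \<omega>) * indicator B \<omega>)
       = (\<Sum>h\<in>PiE {..k} (\<lambda>_. S). F h * prob (cylinder k h \<inter> B))"
proof -
  have "expectation (\<lambda>\<omega>. F (path \<omega>) * indicator B \<omega>)
      = expectation (\<lambda>\<omega>. \<Sum>h\<in>PiE {..k} (\<lambda>_. S). F h * indicator (cylinder k h \<inter> B) \<omega>)"
    by (rule Bochner_Integration.integral_cong[OF refl])
      (simp add: path_determined[OF F] sum_distrib_right indicator_inter_arith mult.assoc)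
  also have "\<dots> = (\<Sum>h\<in>PiE {..k} (\<lambda>_. S). F h * prob (cylinder k h \<inter> B))"
    using B by (subst Bochner_Integration.integral_sum) (auto intro!: integrable_indicator)
  finally show ?thesis .
qed

lemma path_mean_cylinders:
  assumes F: "determined_by k F"
  shows "path_mean F = (\<Sum>h\<in>PiE {..k} (\<lambda>_. S). F h * prob (cylinder k h))"
proof -
  have "path_mean F = expectation (\<lambda>\<omega>. F (path \<omega>) * indicator (space M) \<omega>)"
    unfolding path_mean_def by (rule Bochner_Integration.integral_cong) auto
  also have "\<dots> = (\<Sum>h\<in>PiE {..k} (\<lambda>_. S). F h * prob (cylinder k h \<inter> space M))"
    by (rule mean_indicator[OF F]) simp
  also have "\<dots> = (\<Sum>h\<in>PiE {..k} (\<lambda>_. S). F h * prob (cylinder k h))"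
    by (simp add: Int_absorb2 sets.sets_into_space)
  finally show ?thesis .
qed

lemma path_mean_cong: "(\<And>\<omega>. \<omega> \<in> space M \<Longrightarrow> F (path \<omega>) = G (path \<omega>)) \<Longrightarrow> path_mean F = path_mean G"
  unfolding path_mean_def by (rule Bochner_Integration.integral_cong) auto

lemma path_mean_sum:
  assumes "\<And>i. i \<in> I \<Longrightarrow> determined_by (k i) (F i)"
  shows "path_mean (\<lambda>n. \<Sum>i\<in>I. F i n) = (\<Sum>i\<in>I. path_mean (F i))"
  unfolding path_mean_def
  by (rule Bochner_Integration.integral_sum) (use assms in \<open>rule integrable_determined\<close>)

lemma path_mean_diff:
  assumes "determined_by k F" "determined_by l G"
  shows "path_mean (\<lambda>n. F n - G n) = path_mean F - path_mean G"
  unfolding path_mean_def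
  by (rule Bochner_Integration.integral_diff) (use assms in \<open>auto intro: integrable_determined\<close>)

lemma path_mean_cmult: "path_mean (\<lambda>n. F n * c) = path_mean F * (c :: real)"
  unfolding path_mean_def by simp

lemma path_mean_mono:
  assumes "determined_by k F" "determined_by l G"
    and "\<And>\<omega>. \<omega> \<in> space M \<Longrightarrow> F (path \<omega>) \<le> G (path \<omega>)"
  shows "path_mean F \<le> path_mean G"
  unfolding path_mean_def
  by (rule integral_mono) (use assms in \<open>auto intro: integrable_determined\<close>)

lemma path_mean_nonneg: "(\<And>\<omega>. \<omega> \<in> space M \<Longrightarrow> 0 \<le> F (path \<omega>)) \<Longrightarrow> 0 \<le> path_mean F"
  unfolding path_mean_def by (rule integral_nonneg_AE) auto

lemma path_event:
  assumes "determined_by k P"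
  shows "{\<omega> \<in> space M. P (path \<omega>)} \<in> events"
proof -
  have "determined_by k (\<lambda>n. of_bool (P n) :: real)" using assms by (rule determined_by_comp)
  then have "(\<lambda>\<omega>. of_bool (P (path \<omega>)) :: real) \<in> borel_measurable M"
    by (rule measurable_determined)
  then have "{\<omega> \<in> space M. of_bool (P (path \<omega>)) = (1::real)} \<in> events"
    by measurable
  then show ?thesis by simp
qed

lemma path_mean_of_bool:
  assumes "determined_by k P"
  shows "path_mean (\<lambda>n. of_bool (P n)) = prob {\<omega> \<in> space M. P (path \<omega>)}"
proof -
  have "path_mean (\<lambda>n. of_bool (P n)) = expectation (indicator {\<omega> \<in> space M. P (path \<omega>)})"
    unfolding path_mean_def by (rule Bochner_Integration.integral_cong) (auto simp: indicator_def)
  then show ?thesis using path_event[OF assms] by simp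
qed

text \<open>
  Multiplying out the conditional probability removes the condition that the history has positive
  probability, since both sides vanish for a null history.
\<close>

lemma markov_cylinder:
  assumes "h k \<in> S" and "j \<in> S"
  shows "prob (cylinder k h \<inter> {\<omega> \<in> space M. N (Suc k) \<omega> = j}) = prob (cylinder k h) * Q (h k) j"
proof (cases "prob (cylinder k h) = 0")
  case True
  have "prob (cylinder k h \<inter> {\<omega> \<in> space M. N (Suc k) \<omega> = j}) \<le> prob (cylinder k h)"
    by (rule finite_measure_mono) auto
  then show ?thesis using True by (simp add: measure_le_0_iff)
next
  case False
  then have pos: "0 < prob (cylinder k h)" by (simp add: zero_less_measure_iff)
  then have "\<P>(\<omega> in M. N (Suc k) \<omega> = j \<bar> \<forall>m\<le>k. N m \<omega> = h m) = Q (h k) j"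
    using chain assms(2) unfolding homogeneous_markov_chain_def cylinder_def by blast
  moreover have "cylinder k h \<inter> {\<omega> \<in> space M. N (Suc k) \<omega> = j}
      = {\<omega> \<in> space M. N (Suc k) \<omega> = j \<and> (\<forall>m\<le>k. N m \<omega> = h m)}"
    by (auto simp: cylinder_def)
  ultimately show ?thesis using pos
    by (simp add: cond_prob_def cylinder_def field_simps)
qed

lemma markov_step:
  assumes F: "determined_by k F" and j: "j \<in> S"
  shows "path_mean (\<lambda>n. F n * of_bool (n (Suc k) = j)) = path_mean (\<lambda>n. F n * Q (n k) j)"
proof -
  let ?B = "{\<omega> \<in> space M. N (Suc k) \<omega> = j}"
  have "path_mean (\<lambda>n. F n * of_bool (n (Suc k) = j))
      = expectation (\<lambda>\<omega>. F (path \<omega>) * indicator ?B \<omega>)"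
    unfolding path_mean_def by (rule Bochner_Integration.integral_cong) (auto simp: indicator_def)
  also have "\<dots> = (\<Sum>h\<in>PiE {..k} (\<lambda>_. S). F h * prob (cylinder k h \<inter> ?B))"
    by (rule mean_indicator[OF F]) measurable
  also have "\<dots> = (\<Sum>h\<in>PiE {..k} (\<lambda>_. S). F h * Q (h k) j * prob (cylinder k h))"
    using j by (intro sum.cong) (auto simp: markov_cylinder PiE_iff)
  also have "\<dots> = path_mean (\<lambda>n. F n * Q (n k) j)"
    by (rule path_mean_cylinders[symmetric])
      (intro determined_by_comp2[OF F, where g = "(*)"] determined_by_coord order_refl)
  finally show ?thesis .
qed

lemma markov_future_cylinder:
  assumes F: "determined_by k F" and h: "\<And>m. m \<le> j \<Longrightarrow> h m \<in> S"
  shows "path_mean (\<lambda>n. F n * of_bool (\<forall>m\<le>j. n (k + m) = h m))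
       = path_mean (\<lambda>n. F n * of_bool (n k = h 0)) * (\<Prod>m<j. Q (h m) (h (Suc m)))"
  using h
proof (induction j)
  case 0
  then show ?case by simp
next
  case (Suc j)
  define F' where "F' = (\<lambda>n. F n * of_bool (\<forall>m\<le>j. n (k + m) = h m))"
  have F': "determined_by (k + j) F'"
    unfolding F'_def determined_by_def by (auto intro!: arg_cong2[where f = "(*)"] determined_byD[OF F])
  have "path_mean (\<lambda>n. F n * of_bool (\<forall>m\<le>Suc j. n (k + m) = h m))
      = path_mean (\<lambda>n. F' n * of_bool (n (Suc (k + j)) = h (Suc j)))"
    by (rule path_mean_cong) (auto simp: F'_def le_Suc_eq)
  also have "\<dots> = path_mean (\<lambda>n. F' n * Q (n (k + j)) (h (Suc j)))"
    using Suc.prems by (intro markov_step F') simp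
  also have "\<dots> = path_mean (\<lambda>n. F' n * Q (h j) (h (Suc j)))"
    by (rule path_mean_cong) (auto simp: F'_def)
  also have "\<dots> = path_mean F' * Q (h j) (h (Suc j))"
    by (rule path_mean_cmult)
  finally show ?case using Suc by (simp add: F'_def)
qed

lemma markov_power:
  assumes "determined_by k F" and s: "s \<in> S"
  shows "path_mean (\<lambda>n. F n * of_bool (n (k + t) = s))
       = path_mean (\<lambda>n. F n * matrix_pow S Q t (n k) s)"
  using assms(1)
proof (induction t arbitrary: k)
  case 0
  then show ?case by (simp add: of_bool_def)
next
  case (Suc t)
  have step: "determined_by (Suc k) (\<lambda>n. F n * of_bool (n (Suc k) = l) * c)"
    "determined_by k (\<lambda>n. F n * Q (n k) l * c)" for l and c :: real
    using Suc.prems unfolding determined_by_def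
    by (auto intro!: arg_cong2[where f = "(*)"] )
  have "path_mean (\<lambda>n. F n * of_bool (n (k + Suc t) = s))
      = path_mean (\<lambda>n. F n * matrix_pow S Q t (n (Suc k)) s)"
    using Suc.IH[OF determined_by_mono[OF Suc.prems le_SucI[OF order_refl]]] by simp
  also have "\<dots> = path_mean (\<lambda>n. \<Sum>l\<in>S. F n * of_bool (n (Suc k) = l) * matrix_pow S Q t l s)"
    by (rule path_mean_cong)
       (simp add: finite_S N_in_S of_bool_def if_distrib if_distribR cong: if_cong)
  also have "\<dots> = (\<Sum>l\<in>S. path_mean (\<lambda>n. F n * of_bool (n (Suc k) = l)) * matrix_pow S Q t l s)"
    by (simp only: path_mean_sum[OF step(1)] path_mean_cmult)
  also have "\<dots> = (\<Sum>l\<in>S. path_mean (\<lambda>n. F n * Q (n k) l) * matrix_pow S Q t l s)"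
    using Suc.prems by (simp add: markov_step)
  also have "\<dots> = path_mean (\<lambda>n. \<Sum>l\<in>S. F n * Q (n k) l * matrix_pow S Q t l s)"
    by (simp only: path_mean_sum[OF step(2)] path_mean_cmult)
  also have "\<dots> = path_mean (\<lambda>n. F n * matrix_pow S Q (Suc t) (n k) s)"
    by (simp add: sum_distrib_left mult.assoc)
  finally show ?case .
qed

text \<open>
  Given that the chain is at \<open>a\<close> at time \<open>k\<close>, the future is a copy of the chain started at \<open>a\<close>, and it is
  independent of the past. Both means expand into the same products of transition probabilities over
  future cylinders.
\<close>

lemma regeneration:
  assumes start: "\<And>\<omega>. \<omega> \<in> space M \<Longrightarrow> N 0 \<omega> = a"
    and F: "determined_by k F" and Fa: "\<And>\<omega>. \<omega> \<in> space M \<Longrightarrow> F (path \<omega>) \<noteq> 0 \<Longrightarrow> N k \<omega> = a"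
    and G: "determined_by j G"
  shows "path_mean (\<lambda>n. F n * G (\<lambda>m. n (k + m))) = path_mean F * path_mean G"
proof -
  let ?H = "PiE {..j} (\<lambda>_. S)"
  have det: "determined_by (k + j) (\<lambda>n. F n * of_bool (\<forall>m\<le>j. n (k + m) = h m) * c)" for h and c :: real
    unfolding determined_by_def by (auto intro!: arg_cong2[where f = "(*)"] determined_byD[OF F])
  have cyl: "path_mean (\<lambda>n. F n * of_bool (\<forall>m\<le>j. n (k + m) = h m)) = path_mean F * prob (cylinder j h)"
    if h: "h \<in> ?H" for h
  proof -
    have hS: "\<And>m. m \<le> j \<Longrightarrow> h m \<in> S" using h by (auto simp: PiE_iff)
    have "prob (cylinder j h) = path_mean (\<lambda>n. 1 * of_bool (\<forall>m\<le>j. n (0 + m) = h m))"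
      using path_mean_of_bool[of j "\<lambda>n. \<forall>m\<le>j. n m = h m"]
      by (simp add: cylinder_def determined_by_def)
    also have "\<dots> = path_mean (\<lambda>n. 1 * of_bool (n 0 = h 0)) * (\<Prod>m<j. Q (h m) (h (Suc m)))"
      by (rule markov_future_cylinder) (auto intro: hS determined_by_const)
    also have "path_mean (\<lambda>n. 1 * of_bool (n 0 = h 0)) = of_bool (h 0 = a)"
      unfolding path_mean_def
      by (subst Bochner_Integration.integral_cong[OF refl, where g = "\<lambda>_. of_bool (h 0 = a)"])
        (auto simp: start prob_space)
    finally have 1: "prob (cylinder j h) = of_bool (h 0 = a) * (\<Prod>m<j. Q (h m) (h (Suc m)))" .
    have "path_mean (\<lambda>n. F n * of_bool (n k = h 0)) = path_mean (\<lambda>n. F n * of_bool (h 0 = a))"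
      by (rule path_mean_cong) (use Fa in fastforce)
    also have "\<dots> = path_mean F * of_bool (h 0 = a)" by (rule path_mean_cmult)
    finally show ?thesis
      using markov_future_cylinder[OF F hS] 1 by simp
  qed
  have "path_mean (\<lambda>n. F n * G (\<lambda>m. n (k + m)))
      = path_mean (\<lambda>n. \<Sum>h\<in>?H. F n * of_bool (\<forall>m\<le>j. n (k + m) = h m) * G h)"
    by (rule path_mean_cong, subst sum_histories[OF G])
       (auto simp: N_in_S sum_distrib_left mult_ac)
  also have "\<dots> = (\<Sum>h\<in>?H. path_mean (\<lambda>n. F n * of_bool (\<forall>m\<le>j. n (k + m) = h m)) * G h)"
    by (simp only: path_mean_sum[OF det] path_mean_cmult)
  also have "\<dots> = path_mean F * path_mean G"
    by (simp add: cyl path_mean_cylinders[OF G] sum_distrib_left mult_ac)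
  finally show ?thesis .
qed

text \<open>
  Two nonnegative functions, one of the random variable and one of the process, have product mean as soon as
  they are measurable for the two generated sigma-algebras. The function of the process is, because every
  cylinder lies in the sigma-algebra generated by the process.
\<close>

lemma nn_integral_indep_process:
  fixes X :: "'w \<Rightarrow> 'a::topological_space" and g :: "'a \<Rightarrow> ennreal"
  assumes indep: "indep_of_process M X N" and X [measurable]: "X \<in> borel_measurable M"
    and g [measurable]: "g \<in> borel_measurable borel"
    and F: "determined_by k F" and nonneg: "\<And>n. 0 \<le> F n"
  shows "(\<integral>\<^sup>+ \<omega>. ennreal (F (path \<omega>)) * g (X \<omega>) \<partial>M) = ennreal (path_mean F) * (\<integral>\<^sup>+ \<omega>. g (X \<omega>) \<partial>M)"
proof -
  let ?AX = "vimage_algebra (space M) X borel"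
  let ?AN = "vimage_algebra (space M) path (Pi\<^sub>M UNIV (\<lambda>_. count_space UNIV))"
  let ?Y = "\<lambda>b \<omega>. if b then g (X \<omega>) else ennreal (F (path \<omega>))"
  have meas: "?Y b \<in> borel_measurable M" for b
    using measurable_determined[OF F] by simp
  have "X \<in> measurable ?AX borel" by (rule measurable_vimage_algebra1) simp
  then have "?Y True \<in> borel_measurable ?AX" by simp
  then have X_sub: "sets (vimage_algebra (space M) (?Y True) borel) \<subseteq> sets ?AX"
    by (simp add: measurable_iff_sets)
  have coord: "N m \<in> measurable ?AN (count_space UNIV)" for m
  proof -
    have "path \<in> measurable ?AN (Pi\<^sub>M UNIV (\<lambda>_. count_space UNIV))"
      by (rule measurable_vimage_algebra1) (simp add: space_PiM)
    then show ?thesis by (rule measurable_compose) (rule measurable_component_singleton, simp)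
  qed
  have cyl: "cylinder k h \<in> sets ?AN" for h
  proof -
    have "cylinder k h = (\<Inter>m\<in>{..k}. N m -` {h m} \<inter> space ?AN)"
      by (auto simp: cylinder_def)
    also have "\<dots> \<in> sets ?AN"
      by (intro sets.finite_INT measurable_sets[OF coord]) auto
    finally show ?thesis .
  qed
  have "(\<lambda>\<omega>. ennreal (\<Sum>h\<in>PiE {..k} (\<lambda>_. S). F h * indicator (cylinder k h) \<omega>)) \<in> borel_measurable ?AN"
    by (intro measurable_compose[OF _ measurable_ennreal] borel_measurable_sum
        borel_measurable_times borel_measurable_const borel_measurable_indicator cyl)
  moreover have "?Y False \<omega> = ennreal (\<Sum>h\<in>PiE {..k} (\<lambda>_. S). F h * indicator (cylinder k h) \<omega>)"
    if "\<omega> \<in> space ?AN" for \<omega>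
    using path_determined[OF F, of \<omega>] that by simp
  ultimately have "?Y False \<in> borel_measurable ?AN"
    by (subst measurable_cong)
  then have N_sub: "sets (vimage_algebra (space M) (?Y False) borel) \<subseteq> sets ?AN"
    by (simp add: measurable_iff_sets)
  have "indep_set (sets (vimage_algebra (space M) (?Y True) borel))
                  (sets (vimage_algebra (space M) (?Y False) borel))"
    using indep X_sub N_sub unfolding indep_of_process_def indep_sets2_eq by blast
  then have "indep_var borel (?Y True) borel (?Y False)"
    using meas[of True] meas[of False] unfolding indep_var_eq sets_vimage_algebra by blast
  moreover have "case_bool borel borel = (\<lambda>_. borel :: ennreal measure)"
    and "case_bool (?Y True) (?Y False) = ?Y"
    by (auto simp: fun_eq_iff split: bool.split)
  ultimately have "indep_vars (\<lambda>_. borel) ?Y UNIV"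
    unfolding indep_var_def by (simp only:)
  then have "(\<integral>\<^sup>+ \<omega>. (\<Prod>b\<in>UNIV. ?Y b \<omega>) \<partial>M) = (\<Prod>b\<in>UNIV. \<integral>\<^sup>+ \<omega>. ?Y b \<omega> \<partial>M)"
    by (intro indep_vars_nn_integral) auto
  then have "(\<integral>\<^sup>+ \<omega>. ennreal (F (path \<omega>)) * g (X \<omega>) \<partial>M)
      = (\<integral>\<^sup>+ \<omega>. ennreal (F (path \<omega>)) \<partial>M) * (\<integral>\<^sup>+ \<omega>. g (X \<omega>) \<partial>M)"
    by (simp add: UNIV_bool mult.commute)
  also have "(\<integral>\<^sup>+ \<omega>. ennreal (F (path \<omega>)) \<partial>M) = ennreal (path_mean F)"
    unfolding path_mean_def
    by (rule nn_integral_eq_integral[OF integrable_determined[OF F]]) (simp add: nonneg)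
  finally show ?thesis .
qed

end

section \<open>The buffer along a path\<close>

lemma eff_length_cong: "(\<And>m. m \<le> k \<Longrightarrow> n m = n' m) \<Longrightarrow> eff_length n k = eff_length n' k"
  by (induction k) simp_all

lemma determined_by_eff_length: "k \<le> l \<Longrightarrow> determined_by l (\<lambda>n. eff_length n k)"
  by (intro determined_byI eff_length_cong) simp

lemma eff_length_0_imp: "eff_length n k = 0 \<Longrightarrow> n k = 0"
  by (cases k) (auto simp: eff_length_step_def split: if_splits)

lemma eff_length_le: "(\<And>m. m \<le> k \<Longrightarrow> n m \<le> L) \<Longrightarrow> eff_length n k \<le> L"
proof (induction k)
  case (Suc k)
  then have "eff_length n k \<le> L" "n (Suc k) \<le> L" by simp_all
  then show ?case by (auto simp: eff_length_step_def)
qed (simp add: eff_length_step_def)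

text \<open>
  An empty buffer carries no memory: its length satisfies the same recursion as at time 0, because
  \<open>n k = 0\<close> reproduces the initial condition.
\<close>

lemma eff_length_shift:
  assumes "eff_length n k = 0"
  shows "eff_length n (k + j) = eff_length (\<lambda>m. n (k + m)) j"
proof (induction j)
  case 0
  then show ?case using assms eff_length_0_imp[OF assms] by (simp add: eff_length_step_def)
qed simp

lemma eff_length_zeros:
  assumes "\<And>m. 1 \<le> m \<Longrightarrow> m \<le> r \<Longrightarrow> n (k + m) = 0"
  shows "eff_length n (k + r) = eff_length n k - r"
  using assms
proof (induction r)
  case (Suc r)
  have "n (k + Suc r) = 0" using Suc.prems[of "Suc r"] by simp
  then show ?case using Suc by (simp add: eff_length_step_def)
qed simp

definition first_return :: "nat \<Rightarrow> (nat \<Rightarrow> nat) \<Rightarrow> bool" where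
  "first_return j n \<longleftrightarrow> 0 < j \<and> eff_length n j = 0 \<and> (\<forall>l. 0 < l \<and> l < j \<longrightarrow> eff_length n l \<noteq> 0)"

lemma first_return_unique: "first_return i n \<Longrightarrow> first_return j n \<Longrightarrow> i = j"
  unfolding first_return_def by (metis linorder_neqE_nat)

lemma determined_by_first_return: "determined_by j (first_return j)"
proof (rule determined_byI)
  fix n n' :: "nat \<Rightarrow> nat" assume "\<And>m. m \<le> j \<Longrightarrow> n m = n' m"
  then have "eff_length n l = eff_length n' l" if "l \<le> j" for l
    using that by (intro eff_length_cong) simp
  then show "first_return j n = first_return j n'"
    unfolding first_return_def by (metis less_imp_le order_refl)
qed

lemma first_return_shift:
  assumes "eff_length n m = 0" and "m \<le> k"
  shows "first_return (Suc k - m) (\<lambda>l. n (m + l)) \<longleftrightarrow>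
    eff_length n (Suc k) = 0 \<and> (\<forall>l. m < l \<and> l \<le> k \<longrightarrow> eff_length n l \<noteq> 0)"
proof -
  have "eff_length (\<lambda>l. n (m + l)) j = eff_length n (m + j)" for j
    using eff_length_shift[OF assms(1)] by simp
  then have "first_return (Suc k - m) (\<lambda>l. n (m + l)) \<longleftrightarrow>
    eff_length n (Suc k) = 0 \<and> (\<forall>l. 0 < l \<and> l < Suc k - m \<longrightarrow> eff_length n (m + l) \<noteq> 0)"
    using assms(2) unfolding first_return_def by simp
  also have "(\<forall>l. 0 < l \<and> l < Suc k - m \<longrightarrow> eff_length n (m + l) \<noteq> 0)
    \<longleftrightarrow> (\<forall>l. m < l \<and> l \<le> k \<longrightarrow> eff_length n l \<noteq> 0)" (is "?L \<longleftrightarrow> ?R")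
  proof
    assume ?L
    show ?R
    proof (intro allI impI)
      fix l assume "m < l \<and> l \<le> k"
      then show "eff_length n l \<noteq> 0" using \<open>?L\<close>[rule_format, of "l - m"] by auto
    qed
  qed auto
  finally show ?thesis .
qed

text \<open>
  Exactly one summand can be nonzero, namely the one for the last time up to \<open>k\<close> at which the buffer was
  empty. Such a time exists because the buffer is empty at time 0.
\<close>

lemma last_empty_decomposition:
  assumes "n 0 = 0"
  shows "(of_bool (eff_length n (Suc k) = 0) :: real) =
    (\<Sum>m\<le>k. of_bool (eff_length n m = 0) * of_bool (first_return (Suc k - m) (\<lambda>l. n (m + l))))"
proof -
  define m0 where "m0 = Max {m. m \<le> k \<and> eff_length n m = 0}"
  have fin: "finite {m. m \<le> k \<and> eff_length n m = 0}" by simp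
  have "0 \<in> {m. m \<le> k \<and> eff_length n m = 0}" using assms by (simp add: eff_length_step_def)
  then have m0: "m0 \<le> k" "eff_length n m0 = 0"
    using Max_in[OF fin] unfolding m0_def by blast+
  have after: "eff_length n l \<noteq> 0" if "m0 < l" "l \<le> k" for l
    using Max_ge[OF fin, of l] that unfolding m0_def[symmetric] by auto
  have "of_bool (eff_length n m = 0) * of_bool (first_return (Suc k - m) (\<lambda>l. n (m + l)))
      = (if m = m0 then of_bool (eff_length n (Suc k) = 0) else 0 :: real)" if "m \<le> k" for m
  proof (cases "eff_length n m = 0")
    case True
    then have "m \<le> m0" using after that by (meson not_le)
    then have "(m \<noteq> m0 \<longrightarrow> (\<exists>l. m < l \<and> l \<le> k \<and> eff_length n l = 0))"
      using m0 by (metis le_neq_implies_less)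
    then show ?thesis
      using True first_return_shift[OF True that] m0 after
      by (cases "m = m0") (auto simp del: eff_length.simps)
  qed (use m0 in auto)
  then have "(\<Sum>m\<le>k. of_bool (eff_length n m = 0) * of_bool (first_return (Suc k - m) (\<lambda>l. n (m + l))))
      = (\<Sum>m\<le>k. if m = m0 then of_bool (eff_length n (Suc k) = 0) else 0 :: real)"
    by (intro sum.cong) auto
  then show ?thesis using m0 by simp
qed

lemma Inf_enat_eq_iff:
  "Inf {enat k | k. P k} = enat k \<longleftrightarrow> P k \<and> (\<forall>l<k. \<not> P l)"
proof
  assume e: "Inf {enat k | k. P k} = enat k"
  have "{enat k | k. P k} \<noteq> {}"
  proof
    assume "{enat k | k. P k} = {}"
    with e have "Inf {} = enat k" by (simp only:)
    then show False by (simp add: Inf_enat_def)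
  qed
  then have "Inf {enat k | k. P k} \<in> {enat k | k. P k}"
    unfolding Inf_enat_def by (auto intro: LeastI)
  then have "P k" using e by auto
  moreover have "\<not> P l" if "l < k" for l
    using Inf_lower[of "enat l" "{enat k | k. P k}"] e that by auto
  ultimately show "P k \<and> (\<forall>l<k. \<not> P l)" by blast
next
  assume *: "P k \<and> (\<forall>l<k. \<not> P l)"
  show "Inf {enat k | k. P k} = enat k"
  proof (rule antisym)
    show "Inf {enat k | k. P k} \<le> enat k" using * by (intro Inf_lower) auto
    show "enat k \<le> Inf {enat k | k. P k}" using * by (intro Inf_greatest) (auto simp: not_less[symmetric])
  qed
qed

lemma empty_time_eff_length:
  assumes "n 0 = 0" and "empty_time n i = enat k"
  shows "eff_length n k = 0"
proof (cases i)
  case 0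
  then show ?thesis using assms by (simp add: eff_length_step_def zero_enat_def)
next
  case (Suc i')
  then show ?thesis using assms(2) by (simp only: empty_time.simps Inf_enat_eq_iff) simp
qed

lemma empty_time_Suc_eq:
  assumes "empty_time n i = enat m"
  shows "empty_time n (Suc i) = enat k \<longleftrightarrow>
    m < k \<and> eff_length n k = 0 \<and> (\<forall>l. m < l \<and> l < k \<longrightarrow> eff_length n l \<noteq> 0)"
proof -
  have "(n l, eff_length n l) = (0, 0) \<longleftrightarrow> eff_length n l = 0" for l
    using eff_length_0_imp[of n l] by auto
  then show ?thesis unfolding empty_time.simps Inf_enat_eq_iff assms by auto
qed

lemma empty_time_Suc_finite:
  assumes "empty_time n (Suc i) = enat k"
  obtains m where "empty_time n i = enat m" "m < k"
proof (cases "empty_time n i")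
  case (enat m)
  then show ?thesis using assms empty_time_Suc_eq[OF enat] that by blast
next
  case infinity
  then show ?thesis using assms unfolding empty_time.simps by (simp add: Inf_enat_def)
qed

lemma determined_by_empty_time: "determined_by k (\<lambda>n. empty_time n i = enat k)"
proof (induction i arbitrary: k)
  case 0
  then show ?case by (simp add: determined_by_const)
next
  case (Suc i)
  have eq: "empty_time n (Suc i) = enat k \<longleftrightarrow> (\<exists>m<k. empty_time n i = enat m \<and>
      eff_length n k = 0 \<and> (\<forall>l. m < l \<and> l < k \<longrightarrow> eff_length n l \<noteq> 0))" for n
    by (metis empty_time_Suc_eq empty_time_Suc_finite)
  show ?case
  proof (rule determined_byI)
    fix n n' :: "nat \<Rightarrow> nat" assume a: "\<And>m. m \<le> k \<Longrightarrow> n m = n' m"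
    have "eff_length n l = eff_length n' l" if "l \<le> k" for l
      using that a by (intro eff_length_cong) simp
    moreover have "empty_time n i = enat m \<longleftrightarrow> empty_time n' i = enat m" if "m < k" for m
      using determined_byD[OF Suc, of m n n'] that a by simp
    ultimately show "(empty_time n (Suc i) = enat k) = (empty_time n' (Suc i) = enat k)"
      unfolding eq by (metis less_imp_le order_refl)
  qed
qed

lemma empty_time_Suc_first_return:
  assumes "n 0 = 0"
  shows "(of_bool (empty_time n (Suc i) = enat (Suc k)) :: real) =
    (\<Sum>m\<le>k. of_bool (empty_time n i = enat m) * of_bool (first_return (Suc k - m) (\<lambda>l. n (m + l))))"
proof (cases "empty_time n i")
  case (enat m0)
  have z: "eff_length n m0 = 0" using empty_time_eff_length[OF assms enat] .
  have "(\<Sum>m\<le>k. of_bool (empty_time n i = enat m) * of_bool (first_return (Suc k - m) (\<lambda>l. n (m + l))))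
      = (\<Sum>m\<le>k. if m = m0 then of_bool (first_return (Suc k - m0) (\<lambda>l. n (m0 + l))) else 0 :: real)"
    using enat by (intro sum.cong) auto
  also have "\<dots> = of_bool (m0 \<le> k \<and> first_return (Suc k - m0) (\<lambda>l. n (m0 + l)))"
    by simp
  also have "m0 \<le> k \<and> first_return (Suc k - m0) (\<lambda>l. n (m0 + l)) \<longleftrightarrow> empty_time n (Suc i) = enat (Suc k)"
    unfolding empty_time_Suc_eq[OF enat] using first_return_shift[OF z, of k] by auto
  finally show ?thesis by simp
next
  case infinity
  then show ?thesis by (auto elim!: empty_time_Suc_finite simp del: empty_time.simps)
qed

text \<open>
  Infinite values need care: if \<open>k_i\<close> is infinite, so is \<open>k_(i+1)\<close>, and the difference of the two is again
  infinite, hence not \<open>enat j\<close>.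
\<close>

lemma empty_gap_eq:
  assumes "n 0 = 0" and "1 \<le> j"
  shows "empty_gap n i = enat j \<longleftrightarrow>
    (\<exists>m. empty_time n i = enat m \<and> first_return j (\<lambda>l. n (m + l)))"
proof (cases "empty_time n i")
  case (enat m)
  have z: "eff_length n m = 0" using empty_time_eff_length[OF assms(1) enat] .
  have "empty_gap n i = enat j \<longleftrightarrow> empty_time n (Suc i) = enat (m + j)"
  proof (cases "empty_time n (Suc i)")
    case e2: (enat k)
    then have "m < k" using empty_time_Suc_eq[OF enat] by blast
    then show ?thesis using enat e2 by (auto simp: empty_gap_def simp del: empty_time.simps)
  qed (use enat in \<open>simp add: empty_gap_def del: empty_time.simps\<close>)
  also have "\<dots> \<longleftrightarrow> first_return j (\<lambda>l. n (m + l))"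
    unfolding empty_time_Suc_eq[OF enat]
    using first_return_shift[OF z, of "m + j - 1"] assms(2) by auto
  finally show ?thesis using enat by simp
next
  case infinity
  then have "empty_time n (Suc i) = \<infinity>"
    by (cases "empty_time n (Suc i)") (auto elim!: empty_time_Suc_finite simp del: empty_time.simps)
  then show ?thesis using infinity by (simp add: empty_gap_def del: empty_time.simps)
qed

text \<open>
  The factor by which the Lyapunov function can have grown up to time \<open>k\<close>.
\<close>

definition gain :: "real \<Rightarrow> real \<Rightarrow> (nat \<Rightarrow> nat) \<Rightarrow> nat \<Rightarrow> real" where
  "gain \<alpha> \<rho> n k = (\<Prod>m<k. if eff_length n m = 0 then \<alpha> else \<rho>)"

lemma gain_0 [simp]: "gain \<alpha> \<rho> n 0 = 1"
  by (simp add: gain_def)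

lemma gain_Suc: "gain \<alpha> \<rho> n (Suc k) = gain \<alpha> \<rho> n k * (if eff_length n k = 0 then \<alpha> else \<rho>)"
  by (simp add: gain_def)

lemma gain_nonneg: "0 \<le> \<alpha> \<Longrightarrow> 0 \<le> \<rho> \<Longrightarrow> 0 \<le> gain \<alpha> \<rho> n k"
  by (simp add: gain_def prod_nonneg)

lemma determined_by_gain: "k \<le> l \<Longrightarrow> determined_by l (\<lambda>n. gain \<alpha> \<rho> n k)"
proof (rule determined_byI)
  fix n n' :: "nat \<Rightarrow> nat" assume "k \<le> l" and a: "\<And>m. m \<le> l \<Longrightarrow> n m = n' m"
  have "eff_length n m = eff_length n' m" if "m \<le> l" for m
    using that a by (intro eff_length_cong) simp
  then show "gain \<alpha> \<rho> n k = gain \<alpha> \<rho> n' k"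
    unfolding gain_def using \<open>k \<le> l\<close> by (intro prod.cong) auto
qed

lemma gain_cycle:
  assumes "eff_length n m = 0" and "\<And>l. m < l \<Longrightarrow> l \<le> m + d \<Longrightarrow> eff_length n l \<noteq> 0"
  shows "gain \<alpha> \<rho> n (Suc (m + d)) = gain \<alpha> \<rho> n m * (\<alpha> * \<rho> ^ d)"
  using assms(2)
proof (induction d)
  case 0
  then show ?case using assms(1) by (simp add: gain_Suc)
next
  case (Suc d)
  have "eff_length n (Suc (m + d)) \<noteq> 0" using Suc.prems[of "Suc (m + d)"] by simp
  moreover have "gain \<alpha> \<rho> n (Suc (m + d)) = gain \<alpha> \<rho> n m * (\<alpha> * \<rho> ^ d)"
    using Suc.prems by (intro Suc.IH) simp
  ultimately show ?case
    by (simp add: gain_Suc[of _ _ _ "Suc (m + d)"] del: eff_length.simps)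
qed

text \<open>
  The gain factorises over the cycles between empty buffers; splitting at the previous empty time yields the
  pathwise form of the renewal equation.
\<close>

lemma gain_renewal:
  assumes "n 0 = 0"
  shows "gain \<alpha> \<rho> n (Suc k) * of_bool (eff_length n (Suc k) = 0) =
    (\<Sum>m\<le>k. gain \<alpha> \<rho> n m * of_bool (eff_length n m = 0)
        * of_bool (first_return (Suc k - m) (\<lambda>l. n (m + l))) * (\<alpha> * \<rho> ^ (k - m)))"
  unfolding last_empty_decomposition[where n = n, OF assms] sum_distrib_left
proof (rule sum.cong[OF refl])
  fix m assume "m \<in> {..k}"
  then have m: "m \<le> k" by simp
  show "gain \<alpha> \<rho> n (Suc k) * (of_bool (eff_length n m = 0)
        * of_bool (first_return (Suc k - m) (\<lambda>l. n (m + l))))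
      = gain \<alpha> \<rho> n m * of_bool (eff_length n m = 0)
        * of_bool (first_return (Suc k - m) (\<lambda>l. n (m + l))) * (\<alpha> * \<rho> ^ (k - m))"
  proof (cases "eff_length n m = 0 \<and> first_return (Suc k - m) (\<lambda>l. n (m + l))")
    case True
    then have "\<And>l. m < l \<Longrightarrow> l \<le> m + (k - m) \<Longrightarrow> eff_length n l \<noteq> 0"
      using first_return_shift[of n m k] m by auto
    then have "gain \<alpha> \<rho> n (Suc k) = gain \<alpha> \<rho> n m * (\<alpha> * \<rho> ^ (k - m))"
      using gain_cycle[of n m "k - m" \<alpha> \<rho>] True m by simp
    then show ?thesis using True by simp
  qed auto
qed

text \<open>
  The calculated values in the buffer remain correct while it is being shifted: the plant is
  deterministic and follows its prediction as long as the predicted inputs are applied.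
\<close>

lemma buffer_contents:
  assumes plant: "\<And>k. x (Suc k) = f (x k) (buffer L f \<kappa> n x k 1)"
    and "\<And>k. n k \<le> L" and "1 \<le> L" and "1 \<le> j" "j \<le> L"
  shows "buffer L f \<kappa> n x k j
       = (if j \<le> eff_length n k then \<kappa> (predicted_state f \<kappa> (x k) j) else 0)"
  using assms(4,5)
proof (induction k arbitrary: j)
  case 0
  then show ?case by (simp add: buffer_step_def eff_length_step_def)
next
  case (Suc k)
  show ?case
  proof (cases "n (Suc k) = 0")
    case True
    have le: "eff_length n k \<le> L" using assms(2) by (intro eff_length_le)
    show ?thesis
    proof (cases "j < eff_length n k")
      case j: True
      then have "j < L" using le by simp
      have "x (Suc k) = f (x k) (\<kappa> (x k))"
        using plant[of k] Suc.IH[of 1] j assms(3) by (simp add: predicted_state_def)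
      moreover obtain j' where "j = Suc j'" using Suc.prems by (cases j) auto
      ultimately have "predicted_state f \<kappa> (x (Suc k)) j = predicted_state f \<kappa> (x k) (j + 1)"
        by (simp add: predicted_state_def funpow_Suc_right del: funpow.simps)
      then show ?thesis
        using True j \<open>j < L\<close> Suc.IH[of "j + 1"]
        by (auto simp: buffer_step_def eff_length_step_def)
    next
      case j: False
      then show ?thesis
        using True Suc.prems Suc.IH[of "j + 1"] by (auto simp: buffer_step_def eff_length_step_def)
    qed
  next
    case False
    then show ?thesis by (simp add: buffer_step_def eff_length_step_def)
  qed
qed

lemma lyapunov_gain:
  assumes plant: "\<And>k. x (Suc k) = f (x k) (buffer L f \<kappa> n x k 1)"
    and n: "\<And>k. n k \<le> L" and L: "1 \<le> L"
    and contract: "\<And>z. V (f z (\<kappa> z)) \<le> \<rho> * V z"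
    and open_loop: "\<And>z. V (f z 0) \<le> \<alpha> * V z"
    and nonneg: "0 \<le> \<alpha>" "0 \<le> \<rho>"
  shows "V (x k) \<le> gain \<alpha> \<rho> n k * (V (x 0) :: real)"
proof (induction k)
  case (Suc k)
  have "V (x (Suc k)) \<le> (if eff_length n k = 0 then \<alpha> else \<rho>) * V (x k)"
    using plant[of k] buffer_contents[of x f L \<kappa> n 1 k, OF plant n L _ L] contract open_loop
    by (auto simp: predicted_state_def)
  also have "\<dots> \<le> (if eff_length n k = 0 then \<alpha> else \<rho>) * (gain \<alpha> \<rho> n k * V (x 0))"
    using nonneg by (intro mult_left_mono Suc) auto
  finally show ?case by (simp add: gain_Suc mult_ac)
qed simp

section \<open>Two summation lemmas\<close>

text \<open>
  The partial sums obey \<open>A_(n+1) \<le> 1 + W * A_n\<close>, so they stay below \<open>1 / (1 - W)\<close>. Once convergence is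
  known, the equation is a Cauchy product and the sum satisfies \<open>A = 1 + A * W\<close>.
\<close>

lemma renewal_equation_sums:
  fixes a w :: "nat \<Rightarrow> real"
  assumes a: "\<And>k. 0 \<le> a k" and w: "\<And>j. 0 \<le> w j" "w sums W" "W < 1"
    and a0: "a 0 = 1" and rec: "\<And>k. a (Suc k) = (\<Sum>m\<le>k. a m * w (k - m))"
  shows "a sums (1 / (1 - W))"
proof -
  have W: "(\<Sum>j<n. w j) \<le> W" for n
    using sum_le_suminf[of w "{..<n}"] w by (auto simp: sums_iff)
  have bound: "(\<Sum>k<n. a k) \<le> 1 / (1 - W)" for n
  proof (induction n)
    case 0
    then show ?case using w(3) by simp
  next
    case (Suc n)
    have "(\<Sum>k<n. \<Sum>m\<le>k. a m * w (k - m)) = (\<Sum>(i,j)\<in>{(i,j). i + j < n}. a i * w j)"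
      by (rule sum.triangle_reindex[symmetric])
    also have "\<dots> \<le> (\<Sum>(i,j)\<in>{..<n} \<times> {..<n}. a i * w j)"
      using a w(1) by (intro sum_mono2) auto
    also have "\<dots> = (\<Sum>k<n. a k) * (\<Sum>j<n. w j)"
      by (simp add: sum_product sum.cartesian_product)
    also have "\<dots> \<le> 1 / (1 - W) * W"
      using Suc W a w(1) by (intro mult_mono) (auto intro!: sum_nonneg simp: w(3) less_imp_le)
    finally have "(\<Sum>k<Suc n. a k) \<le> 1 + 1 / (1 - W) * W"
      by (simp only: sum.lessThan_Suc_shift a0 rec add_left_mono)
    also have "\<dots> = 1 / (1 - W)" using w(3) by (simp add: field_simps)
    finally show ?case .
  qed
  have summable: "summable a"
    by (rule summableI_nonneg_bounded[OF a bound])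
  have "(\<lambda>k. a (Suc k)) sums (suminf a * W)"
    unfolding rec using Cauchy_product_sums[of a w] summable w a by (simp add: sums_iff)
  then have "a sums (suminf a * W + 1)"
    using sums_Suc[of a] a0 by simp
  then have "suminf a = suminf a * W + 1" by (simp add: sums_iff)
  then have "suminf a = 1 / (1 - W)" using w(3) by (simp add: field_simps)
  then show ?thesis using summable by (simp add: sums_iff)
qed

text \<open>
  Convergence needs an a priori bound on the partial sums, for which \<open>\<alpha> - \<rho>\<close> is replaced by the nonnegative
  \<open>\<alpha>\<close>; the exact value then follows by summing the recursion.
\<close>

lemma affine_recursion_sums:
  fixes a e :: "nat \<Rightarrow> real"
  assumes a: "\<And>k. 0 \<le> a k" "a sums A" and e: "\<And>k. 0 \<le> e k" "e 0 = 1"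
    and rec: "\<And>k. e (Suc k) = \<rho> * e k + (\<alpha> - \<rho>) * a k"
    and "0 \<le> \<rho>" "\<rho> < 1" "0 \<le> \<alpha>"
  shows "e sums ((1 + (\<alpha> - \<rho>) * A) / (1 - \<rho>))"
proof -
  have A: "(\<Sum>j<n. a j) \<le> A" for n
    using sum_le_suminf[of a "{..<n}"] a by (auto simp: sums_iff)
  have "(\<Sum>k<n. e k) \<le> (1 + \<alpha> * A) / (1 - \<rho>)" for n
  proof (induction n)
    case 0
    then show ?case using A[of 0] assms(6-8) by simp
  next
    case (Suc n)
    have "(\<Sum>k<Suc n. e k) = 1 + (\<Sum>k<n. \<rho> * e k + (\<alpha> - \<rho>) * a k)"
      by (simp only: sum.lessThan_Suc_shift e(2) rec)
    also have "\<dots> \<le> 1 + (\<Sum>k<n. \<rho> * e k + \<alpha> * a k)"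
      using a(1) assms(6) by (intro add_left_mono sum_mono mult_right_mono) auto
    also have "\<dots> = 1 + (\<rho> * (\<Sum>k<n. e k) + \<alpha> * (\<Sum>k<n. a k))"
      by (simp add: sum.distrib sum_distrib_left)
    also have "\<dots> \<le> 1 + (\<rho> * ((1 + \<alpha> * A) / (1 - \<rho>)) + \<alpha> * A)"
      using Suc A assms(6-8) by (intro add_left_mono add_mono mult_left_mono) auto
    also have "\<dots> = (1 + \<alpha> * A) / (1 - \<rho>)" using assms(7) by (simp add: field_simps)
    finally show ?case .
  qed
  then have summable: "summable e"
    by (rule summableI_nonneg_bounded[OF e(1)])
  have "(\<lambda>k. e (Suc k)) sums (\<rho> * suminf e + (\<alpha> - \<rho>) * A)"
    unfolding rec using summable a(2) by (intro sums_add sums_mult summable_sums)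
  then have "e sums (\<rho> * suminf e + (\<alpha> - \<rho>) * A + 1)"
    using sums_Suc[of e] e(2) by simp
  then have "suminf e = \<rho> * suminf e + (\<alpha> - \<rho>) * A + 1" by (simp add: sums_iff)
  then have "suminf e = (1 + (\<alpha> - \<rho>) * A) / (1 - \<rho>)" using assms(7) by (simp add: field_simps)
  then show ?thesis using summable by (simp add: sums_iff)
qed

section \<open>Recurrence of the empty buffer\<close>

locale buffered_chain = finite_markov_chain M "{0..L}" Q N
  for M :: "'w measure" and L Q N +
  assumes L: "1 \<le> L"
    and N_init: "\<And>\<omega>. \<omega> \<in> space M \<Longrightarrow> N 0 \<omega> = 0"
    and irreducible: "irreducible_matrix {0..L} Q"
begin

definition return_prob :: "nat \<Rightarrow> real" where
  "return_prob j = prob {\<omega> \<in> space M. first_return j (path \<omega>)}"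

lemma return_prob_nonneg: "0 \<le> return_prob j"
  by (simp add: return_prob_def)

lemma N_le: "\<omega> \<in> space M \<Longrightarrow> N k \<omega> \<le> L"
  using N_in_S by simp

lemma return_prob_mean: "return_prob j = path_mean (\<lambda>n. of_bool (first_return j n))"
  unfolding return_prob_def by (rule path_mean_of_bool[symmetric]) (rule determined_by_first_return)

lemma regeneration_return:
  assumes F: "determined_by k F"
    and "\<And>\<omega>. \<omega> \<in> space M \<Longrightarrow> F (path \<omega>) \<noteq> 0 \<Longrightarrow> eff_length (path \<omega>) k = 0"
  shows "path_mean (\<lambda>n. F n * of_bool (first_return j (\<lambda>l. n (k + l)))) = path_mean F * return_prob j"
  unfolding return_prob_mean
  by (rule regeneration[where a = 0 and G = "\<lambda>n. of_bool (first_return j n)", OF _ F])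
    (use assms(2) eff_length_0_imp in
      \<open>auto simp: N_init intro: determined_by_comp[OF determined_by_first_return]\<close>)

text \<open>
  If the buffer can become empty at all, then it can be emptied from any situation by moving to a fixed state
  \<open>s\<close> and staying at 0 for the following \<open>r\<close> steps. Either 0 can be repeated, and \<open>L\<close> zeros empty
  every buffer; or 0 is never followed by 0, and then the step that empties the buffer must go from 1 to 0.
\<close>

lemma return_pattern:
  assumes "0 < return_prob j"
  obtains s r where "s \<le> L" "0 < r" "s = 0 \<and> r = L \<or> s = r" "0 < Q s 0" "1 < r \<longrightarrow> 0 < Q 0 0"
proof (cases "0 < Q 0 0")
  case True
  then show ?thesis using that[of 0 L] L by simp
next
  case False
  then have Q00: "Q 0 0 = 0" using Q_nonneg[of 0 0] by simp
  have "Q 1 0 \<noteq> 0"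
  proof
    assume Q10: "Q 1 0 = 0"
    obtain k where j: "j = Suc k"
      using assms by (cases j) (auto simp: return_prob_def first_return_def)
    have zero: "path_mean (\<lambda>n. of_bool (n k = a) * of_bool (n (Suc k) = 0)) = 0" if "Q a 0 = 0" for a
    proof -
      have "path_mean (\<lambda>n. of_bool (n k = a) * of_bool (n (Suc k) = 0))
          = path_mean (\<lambda>n. of_bool (n k = a) * Q (n k) 0)"
        by (rule markov_step) (simp_all add: determined_by_def)
      also have "\<dots> = path_mean (\<lambda>n. 0)"
        using that by (intro path_mean_cong) auto
      finally show ?thesis by (simp add: path_mean_def)
    qed
    \<comment> \<open>A buffer that is empty next has length at most 1 now, and N never exceeds the length.\<close>
    have "of_bool (first_return (Suc k) n) \<le>
        (\<Sum>a\<in>{0,1}. of_bool (n k = a) * of_bool (n (Suc k) = 0) :: real)" for n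
    proof (cases "first_return (Suc k) n")
      case True
      then have "eff_length n (Suc k) = 0" by (simp add: first_return_def)
      then have "n (Suc k) = 0" "eff_length n k \<le> 1"
        by (auto simp: eff_length_step_def split: if_splits)
      moreover have "n k \<le> eff_length n k" by (cases k) (auto simp: eff_length_step_def)
      ultimately have "n (Suc k) = 0" "n k = 0 \<or> n k = 1" by auto
      then show ?thesis by auto
    qed simp
    moreover have "determined_by (Suc k) (\<lambda>n. of_bool (first_return (Suc k) n) :: real)"
      by (rule determined_by_comp) (rule determined_by_first_return)
    moreover have "determined_by (Suc k)
        (\<lambda>n. \<Sum>a\<in>{0,1}. of_bool (n k = a) * of_bool (n (Suc k) = 0) :: real)"
      unfolding determined_by_def by simp
    ultimately have "return_prob j \<le>
        path_mean (\<lambda>n. \<Sum>a\<in>{0,1}. of_bool (n k = a) * of_bool (n (Suc k) = 0))"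
      unfolding return_prob_mean j by (intro path_mean_mono)
    also have "\<dots> = (\<Sum>a\<in>{0,1}. path_mean (\<lambda>n. of_bool (n k = a) * of_bool (n (Suc k) = 0)))"
      by (rule path_mean_sum[where k = "\<lambda>_. Suc k"]) (simp add: determined_by_def)
    also have "\<dots> = 0" using zero Q00 Q10 by simp
    finally show False using assms by simp
  qed
  then have "0 < Q 1 0" using Q_nonneg[of 1 0] L by simp
  then show ?thesis using that[of 1 1] L by simp
qed

text \<open>
  By irreducibility the state \<open>s\<close> of the emptying pattern is reached from each state \<open>a\<close> in some number
  \<open>t a\<close> of steps with positive probability. As the state space is finite, one horizon and one lower bound
  on the probability serve for all \<open>a\<close>. The weight \<open>F\<close> stands for an arbitrary past.
\<close>

lemma uniform_return:
  assumes "0 < return_prob j"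
  shows "\<exists>T. \<exists>\<epsilon>>0. \<forall>k F. determined_by k F \<and> (\<forall>n. 0 \<le> F n) \<longrightarrow>
       path_mean (\<lambda>n. F n * of_bool (\<forall>l. k < l \<and> l \<le> k + T \<longrightarrow> eff_length n l \<noteq> 0))
         \<le> (1 - \<epsilon>) * path_mean F"
proof -
  let ?S = "{0..L}"
  obtain s r where s: "s \<le> L" and r: "0 < r" "s = 0 \<and> r = L \<or> s = r"
    and Qs: "0 < Q s 0" "1 < r \<longrightarrow> 0 < Q 0 0"
    using return_pattern[OF assms] .
  have "\<forall>a\<in>?S. \<exists>t. 0 < matrix_pow ?S Q t a s"
    using irreducible s unfolding irreducible_matrix_def by simp
  then obtain t where t: "\<And>a. a \<in> ?S \<Longrightarrow> 0 < matrix_pow ?S Q (t a) a s"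
    by metis
  define h where "h = (\<lambda>m::nat. if m = 0 then s else 0)"
  define \<delta> where "\<delta> = (\<Prod>m<r. Q (h m) (h (Suc m)))"
  have \<delta>: "0 < \<delta>" unfolding \<delta>_def using Qs by (intro prod_pos) (auto simp: h_def)
  define g where "g = (\<lambda>a. matrix_pow ?S Q (t a) a s * \<delta>)"
  define \<epsilon> where "\<epsilon> = Min (g ` ?S)"
  define T where "T = Max (t ` ?S) + r"
  have g: "\<epsilon> \<le> g a" if "a \<in> ?S" for a using that unfolding \<epsilon>_def by (intro Min_le) auto
  have T: "t a + r \<le> T" if "a \<in> ?S" for a using that unfolding T_def by simp
  have "0 < \<epsilon>" unfolding \<epsilon>_def using t \<delta> by (subst Min_gr_iff) (auto simp: g_def)
  moreover have "path_mean (\<lambda>n. F n * of_bool (\<forall>l. k < l \<and> l \<le> k + T \<longrightarrow> eff_length n l \<noteq> 0))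
         \<le> (1 - \<epsilon>) * path_mean F"
    if F: "determined_by k F" and nonneg: "\<And>n. 0 \<le> F n" for k F
  proof -
    define Fa where "Fa = (\<lambda>a n. F n * of_bool (n k = a))"
    define Ha where "Ha = (\<lambda>a n. Fa a n * of_bool (n (k + t a) = s)
        * of_bool (\<forall>m\<le>r. n (k + t a + m) = h m))"
    have dF: "determined_by k (Fa a)" for a
      unfolding Fa_def by (intro determined_by_comp2[OF F, where g = "(*)"] determined_by_coord order_refl)
    have dG: "determined_by (k + t a) (\<lambda>n. Fa a n * of_bool (n (k + t a) = s))" for a
      by (intro determined_by_comp2[where g = "(*)"] determined_by_coord order_refl
          determined_by_mono[OF dF]) simp
    have dH: "determined_by (k + t a + r) (Ha a)" for a
      unfolding Ha_def
      by (intro determined_by_comp2[where g = "(*)"] determined_by_mono[OF dG])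
        (auto simp: determined_by_def)
    have dd: "determined_by (k + t a + r) (\<lambda>n. Fa a n - Ha a n)" for a
      by (intro determined_by_comp2[where g = "(-)"] dH determined_by_mono[OF dF]) simp
    have mH: "path_mean (Ha a) = path_mean (Fa a) * g a" if "a \<in> ?S" for a
    proof -
      have "path_mean (Ha a) = path_mean (\<lambda>n. Fa a n * of_bool (n (k + t a) = s)
          * of_bool (n (k + t a) = h 0)) * \<delta>"
        unfolding Ha_def \<delta>_def by (rule markov_future_cylinder[OF dG]) (use s in \<open>simp add: h_def\<close>)
      also have "path_mean (\<lambda>n. Fa a n * of_bool (n (k + t a) = s) * of_bool (n (k + t a) = h 0))
          = path_mean (\<lambda>n. Fa a n * of_bool (n (k + t a) = s))"
        by (rule path_mean_cong) (simp add: h_def)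
      also have "\<dots> = path_mean (\<lambda>n. Fa a n * matrix_pow ?S Q (t a) (n k) s)"
        by (rule markov_power[OF dF]) (use s in simp)
      also have "\<dots> = path_mean (\<lambda>n. Fa a n * matrix_pow ?S Q (t a) a s)"
        by (rule path_mean_cong) (simp add: Fa_def)
      also have "\<dots> = path_mean (Fa a) * matrix_pow ?S Q (t a) a s"
        by (rule path_mean_cmult)
      finally show ?thesis by (simp add: g_def mult.assoc)
    qed
    have "path_mean (\<lambda>n. F n * of_bool (\<forall>l. k < l \<and> l \<le> k + T \<longrightarrow> eff_length n l \<noteq> 0))
        \<le> path_mean (\<lambda>n. \<Sum>a\<in>?S. Fa a n - Ha a n)"
    proof (rule path_mean_mono)
      show "determined_by (k + T) (\<lambda>n. F n * of_bool (\<forall>l. k < l \<and> l \<le> k + T \<longrightarrow> eff_length n l \<noteq> 0))"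
      proof (intro determined_by_comp2[where g = "(*)"] determined_by_mono[OF F] determined_byI)
        fix n n' :: "nat \<Rightarrow> nat" assume "\<And>m. m \<le> k + T \<Longrightarrow> n m = n' m"
        then have "eff_length n l = eff_length n' l" if "l \<le> k + T" for l
          using that by (intro eff_length_cong) simp
        then show "of_bool (\<forall>l. k < l \<and> l \<le> k + T \<longrightarrow> eff_length n l \<noteq> 0)
          = (of_bool (\<forall>l. k < l \<and> l \<le> k + T \<longrightarrow> eff_length n' l \<noteq> 0) :: real)" by simp
      qed simp
      show "determined_by (k + T) (\<lambda>n. \<Sum>a\<in>?S. Fa a n - Ha a n)"
      proof (rule determined_byI)
        fix n n' :: "nat \<Rightarrow> nat" assume e: "\<And>m. m \<le> k + T \<Longrightarrow> n m = n' m"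
        show "(\<Sum>a\<in>?S. Fa a n - Ha a n) = (\<Sum>a\<in>?S. Fa a n' - Ha a n')"
          by (intro sum.cong refl determined_byD[OF dd] e) (use T in fastforce)
      qed
      fix \<omega> assume \<omega>: "\<omega> \<in> space M"
      let ?n = "path \<omega>"
      define a where "a = ?n k"
      have a: "a \<in> ?S" using N_in_S[OF \<omega>] by (simp add: a_def)
      have "(\<Sum>b\<in>?S. Fa b ?n - Ha b ?n) = (\<Sum>b\<in>?S. if b = a then Fa a ?n - Ha a ?n else 0)"
        by (rule sum.cong) (auto simp: Ha_def Fa_def a_def)
      also have "\<dots> = Fa a ?n - Ha a ?n" using a by simp
      finally have sum: "(\<Sum>b\<in>?S. Fa b ?n - Ha b ?n) = Fa a ?n - Ha a ?n" .
      show "F ?n * of_bool (\<forall>l. k < l \<and> l \<le> k + T \<longrightarrow> eff_length ?n l \<noteq> 0)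
          \<le> (\<Sum>b\<in>?S. Fa b ?n - Ha b ?n)"
      proof (cases "\<forall>m\<le>r. ?n (k + t a + m) = h m")
        case True
        \<comment> \<open>At state 0 the length is bounded only by L, but then r = L; at s > 0 it is reset to s = r.\<close>
        have "eff_length ?n (k + t a) \<le> r"
        proof (cases "s = 0")
          case True
          then have "r = L" using r by auto
          then show ?thesis using N_le[OF \<omega>] by (auto intro: eff_length_le)
        next
          case False
          have "?n (k + t a) = s" using True[rule_format, of 0] by (simp add: h_def)
          moreover have "eff_length ?n m = ?n m" if "?n m \<noteq> 0" for m
            using that by (cases m) (auto simp: eff_length_step_def)
          ultimately show ?thesis using False r by auto
        qed
        moreover have "eff_length ?n (k + t a + r) = eff_length ?n (k + t a) - r"
          using True by (intro eff_length_zeros) (simp add: h_def)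
        ultimately have "eff_length ?n (k + t a + r) = 0" by simp
        moreover have "k < k + t a + r" "k + t a + r \<le> k + T" using r T[OF a] by auto
        ultimately have "\<not> (\<forall>l. k < l \<and> l \<le> k + T \<longrightarrow> eff_length ?n l \<noteq> 0)" by blast
        then have "(of_bool (\<forall>l. k < l \<and> l \<le> k + T \<longrightarrow> eff_length ?n l \<noteq> 0) :: real) = 0"
          by (simp only: of_bool_eq_0_iff not_False_eq_True)
        then have "F ?n * of_bool (\<forall>l. k < l \<and> l \<le> k + T \<longrightarrow> eff_length ?n l \<noteq> 0) = 0"
          by (simp only: mult_zero_right)
        also have "0 \<le> Fa a ?n - Ha a ?n" using nonneg[of ?n] by (simp add: Ha_def Fa_def)
        finally show ?thesis unfolding sum .
      next
        case False
        then have "Ha a ?n = 0" by (simp add: Ha_def)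
        then show ?thesis unfolding sum using nonneg[of ?n] by (simp add: Fa_def a_def)
      qed
    qed
    also have "\<dots> = (\<Sum>a\<in>?S. path_mean (\<lambda>n. Fa a n - Ha a n))"
      by (rule path_mean_sum[OF dd])
    also have "\<dots> = (\<Sum>a\<in>?S. path_mean (Fa a) - path_mean (Ha a))"
      by (simp add: path_mean_diff[OF dF dH])
    also have "\<dots> \<le> (\<Sum>a\<in>?S. path_mean (Fa a) * (1 - \<epsilon>))"
    proof (rule sum_mono)
      fix a assume a: "a \<in> ?S"
      have "0 \<le> path_mean (Fa a)" using nonneg by (intro path_mean_nonneg) (simp add: Fa_def)
      then have "path_mean (Fa a) * \<epsilon> \<le> path_mean (Fa a) * g a"
        by (intro mult_left_mono g[OF a])
      then show "path_mean (Fa a) - path_mean (Ha a) \<le> path_mean (Fa a) * (1 - \<epsilon>)"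
        by (simp add: mH[OF a] algebra_simps)
    qed
    also have "\<dots> = path_mean (\<lambda>n. \<Sum>a\<in>?S. Fa a n) * (1 - \<epsilon>)"
      by (simp add: path_mean_sum[OF dF] sum_distrib_right)
    also have "path_mean (\<lambda>n. \<Sum>a\<in>?S. Fa a n) = path_mean F"
      by (rule path_mean_cong) (use N_in_S in \<open>simp add: Fa_def of_bool_def if_distrib cong: if_cong\<close>)
    finally show ?thesis by (simp add: mult.commute)
  qed
  ultimately show ?thesis by blast
qed

lemma return_prob_sums:
  "(\<lambda>j. return_prob (Suc j)) sums prob {\<omega> \<in> space M. \<exists>l>0. eff_length (path \<omega>) l = 0}"
proof -
  let ?A = "\<lambda>j. {\<omega> \<in> space M. first_return (Suc j) (path \<omega>)}"
  have "(\<lambda>j. prob (?A j)) sums prob (\<Union>j. ?A j)"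
  proof (rule finite_measure_UNION)
    show "range ?A \<subseteq> events" using path_event[OF determined_by_first_return] by auto
    show "disjoint_family ?A"
      unfolding disjoint_family_on_def using first_return_unique by blast
  qed
  also have "(\<Union>j. ?A j) = {\<omega> \<in> space M. \<exists>l>0. eff_length (path \<omega>) l = 0}"
  proof (intro equalityI subsetI)
    fix \<omega> assume "\<omega> \<in> (\<Union>j. ?A j)"
    then show "\<omega> \<in> {\<omega> \<in> space M. \<exists>l>0. eff_length (path \<omega>) l = 0}"
      by (auto simp: first_return_def simp del: eff_length.simps)
  next
    fix \<omega> assume \<omega>: "\<omega> \<in> {\<omega> \<in> space M. \<exists>l>0. eff_length (path \<omega>) l = 0}"
    let ?P = "\<lambda>l. 0 < l \<and> eff_length (path \<omega>) l = 0"
    obtain l where "?P l" using \<omega> by blast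
    then obtain m where m: "?P m" "\<And>l. l < m \<Longrightarrow> \<not> ?P l"
      using exists_least_iff[of ?P] by blast
    have "first_return m (path \<omega>)"
      unfolding first_return_def using m(1) by (auto dest: m(2) simp del: eff_length.simps)
    moreover obtain j where "m = Suc j"
      using m(1) by (cases m) auto
    ultimately have "first_return (Suc j) (path \<omega>)" by simp
    then show "\<omega> \<in> (\<Union>j. ?A j)" using \<omega> by blast
  qed
  finally show ?thesis unfolding return_prob_def .
qed

lemma no_return_event:
  "determined_by k (\<lambda>n. \<forall>l. 0 < l \<and> l \<le> k \<longrightarrow> eff_length n l \<noteq> 0)"
proof (rule determined_byI)
  fix n n' :: "nat \<Rightarrow> nat" assume "\<And>m. m \<le> k \<Longrightarrow> n m = n' m"
  then have "eff_length n l = eff_length n' l" if "l \<le> k" for l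
    using that by (intro eff_length_cong) simp
  then show "(\<forall>l. 0 < l \<and> l \<le> k \<longrightarrow> eff_length n l \<noteq> 0)
          = (\<forall>l. 0 < l \<and> l \<le> k \<longrightarrow> eff_length n' l \<noteq> 0)" by simp
qed

text \<open>
  Surviving \<open>m\<close> consecutive blocks of length \<open>T\<close> without an empty buffer has probability at most
  \<open>(1 - \<epsilon>)^m\<close>, which tends to 0.
\<close>

lemma recurrence:
  assumes "0 < return_prob j"
  shows "(\<lambda>j. return_prob (Suc j)) sums 1"
proof -
  let ?never = "\<lambda>k n. \<forall>l. 0 < l \<and> l \<le> k \<longrightarrow> eff_length n l \<noteq> 0"
  obtain \<epsilon> :: real and T :: nat where \<epsilon>: "0 < \<epsilon>" and avoid:
    "\<And>k F. determined_by k F \<Longrightarrow> (\<And>n. 0 \<le> F n) \<Longrightarrow>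
       path_mean (\<lambda>n. F n * of_bool (\<forall>l. k < l \<and> l \<le> k + T \<longrightarrow> eff_length n l \<noteq> 0))
         \<le> (1 - \<epsilon>) * path_mean F"
    using uniform_return[OF assms] by blast
  have one: "path_mean (\<lambda>_. 1) = 1" by (simp add: path_mean_def prob_space)
  have "0 \<le> path_mean (\<lambda>n. 1 * of_bool (\<forall>l. 0 < l \<and> l \<le> 0 + T \<longrightarrow> eff_length n l \<noteq> 0))"
    by (rule path_mean_nonneg) simp
  also have "\<dots> \<le> (1 - \<epsilon>) * path_mean (\<lambda>_. 1)"
    by (rule avoid) (simp_all add: determined_by_const)
  finally have \<epsilon>1: "\<epsilon> \<le> 1" using one by simp
  have tail: "path_mean (\<lambda>n. of_bool (?never (m * T) n)) \<le> (1 - \<epsilon>) ^ m" for m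
  proof (induction m)
    case 0
    then show ?case using one by simp
  next
    case (Suc m)
    have "path_mean (\<lambda>n. of_bool (?never (Suc m * T) n))
        = path_mean (\<lambda>n. of_bool (?never (m * T) n)
            * of_bool (\<forall>l. m * T < l \<and> l \<le> m * T + T \<longrightarrow> eff_length n l \<noteq> 0))"
    proof (rule path_mean_cong)
      fix \<omega>
      have "?never (Suc m * T) n \<longleftrightarrow> ?never (m * T) n \<and>
          (\<forall>l. m * T < l \<and> l \<le> m * T + T \<longrightarrow> eff_length n l \<noteq> 0)" for n
        by (auto simp: add.commute) (meson not_le)
      then show "(of_bool (?never (Suc m * T) (path \<omega>)) :: real)
        = of_bool (?never (m * T) (path \<omega>))
            * of_bool (\<forall>l. m * T < l \<and> l \<le> m * T + T \<longrightarrow> eff_length (path \<omega>) l \<noteq> 0)"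
        by (simp only: of_bool_conj)
    qed
    also have "\<dots> \<le> (1 - \<epsilon>) * path_mean (\<lambda>n. of_bool (?never (m * T) n))"
      by (rule avoid) (rule determined_by_comp[OF no_return_event], simp)
    also have "\<dots> \<le> (1 - \<epsilon>) * (1 - \<epsilon>) ^ m"
      using Suc \<epsilon>1 by (intro mult_left_mono) auto
    finally show ?case by simp
  qed
  let ?R = "{\<omega> \<in> space M. \<exists>l>0. eff_length (path \<omega>) l = 0}"
  have R: "?R \<in> events"
  proof -
    have "?R = (\<Union>l\<in>{0<..}. {\<omega> \<in> space M. eff_length (path \<omega>) l = 0})" by auto
    moreover have "{\<omega> \<in> space M. eff_length (path \<omega>) l = 0} \<in> events" for l
      by (rule path_event[where k = l and P = "\<lambda>n. eff_length n l = 0"])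
        (rule determined_by_comp[OF determined_by_eff_length[OF order_refl]])
    ultimately show ?thesis by (simp only:) (intro sets.countable_UN' ; auto)
  qed
  have le: "1 - prob ?R \<le> (1 - \<epsilon>) ^ m" for m
  proof -
    have "1 - prob ?R = prob (space M - ?R)" using prob_compl[OF R] by simp
    also have "\<dots> \<le> prob {\<omega> \<in> space M. ?never (m * T) (path \<omega>)}"
    proof (rule finite_measure_mono)
      show "space M - ?R \<subseteq> {\<omega> \<in> space M. ?never (m * T) (path \<omega>)}"
        by (intro subsetI) (simp, metis less_irrefl)
      show "{\<omega> \<in> space M. ?never (m * T) (path \<omega>)} \<in> events"
        by (rule path_event) (rule no_return_event)
    qed
    also have "\<dots> \<le> (1 - \<epsilon>) ^ m"
      using tail[of m] by (simp only: path_mean_of_bool[OF no_return_event])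
    finally show ?thesis .
  qed
  have "1 - prob ?R \<le> 0"
    using \<epsilon> \<epsilon>1 by (intro LIMSEQ_le_const[OF LIMSEQ_power_zero[of "1 - \<epsilon>"]]) (auto intro: le)
  then have "prob ?R = 1" using prob_le_1[of ?R] by simp
  then show ?thesis using return_prob_sums by simp
qed

section \<open>Distribution of the gaps and sum of the mean gains\<close>

definition empty_time_prob :: "nat \<Rightarrow> nat \<Rightarrow> real" where
  "empty_time_prob i k = prob {\<omega> \<in> space M. empty_time (path \<omega>) i = enat k}"

lemma empty_time_prob_mean:
  "empty_time_prob i k = path_mean (\<lambda>n. of_bool (empty_time n i = enat k))"
  unfolding empty_time_prob_def by (rule path_mean_of_bool[symmetric]) (rule determined_by_empty_time)

lemma empty_time_prob_renewal:
  "path_mean (\<lambda>n. of_bool (empty_time n i = enat m) * of_bool (first_return j (\<lambda>l. n (m + l))))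
   = empty_time_prob i m * return_prob j"
  unfolding empty_time_prob_mean
proof (rule regeneration_return)
  show "determined_by m (\<lambda>n. of_bool (empty_time n i = enat m) :: real)"
    by (rule determined_by_comp) (rule determined_by_empty_time)
  show "eff_length (path \<omega>) m = 0"
    if "\<omega> \<in> space M" "of_bool (empty_time (path \<omega>) i = enat m) \<noteq> (0::real)" for \<omega>
    using that N_init empty_time_eff_length[of "path \<omega>" i m] by simp
qed

lemma determined_by_renewal_event:
  assumes "m + j \<le> l"
  shows "determined_by l (\<lambda>n. empty_time n i = enat m \<and> first_return j (\<lambda>l. n (m + l)))"
  using assms
  by (intro determined_by_comp2[where g = "(\<and>)"] determined_by_mono[OF determined_by_empty_time]
      determined_by_shift[OF determined_by_first_return]) auto

lemma empty_time_prob_Suc: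
  "empty_time_prob (Suc i) (Suc k) = (\<Sum>m\<le>k. empty_time_prob i m * return_prob (Suc k - m))"
proof -
  have "empty_time_prob (Suc i) (Suc k) = path_mean (\<lambda>n. \<Sum>m\<le>k.
      of_bool (empty_time n i = enat m) * of_bool (first_return (Suc k - m) (\<lambda>l. n (m + l))))"
    unfolding empty_time_prob_mean
    by (rule path_mean_cong) (rule empty_time_Suc_first_return, rule N_init)
  also have "\<dots> = (\<Sum>m\<le>k. path_mean (\<lambda>n.
      of_bool (empty_time n i = enat m) * of_bool (first_return (Suc k - m) (\<lambda>l. n (m + l)))))"
  proof (rule path_mean_sum)
    fix m assume "m \<in> {..k}"
    then have "determined_by (Suc k)
        (\<lambda>n. empty_time n i = enat m \<and> first_return (Suc k - m) (\<lambda>l. n (m + l)))"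
      by (intro determined_by_renewal_event) simp
    then have "determined_by (Suc k)
        (\<lambda>n. of_bool (empty_time n i = enat m \<and> first_return (Suc k - m) (\<lambda>l. n (m + l))) :: real)"
      by (rule determined_by_comp)
    then show "determined_by (Suc k) (\<lambda>n. of_bool (empty_time n i = enat m)
        * of_bool (first_return (Suc k - m) (\<lambda>l. n (m + l))) :: real)"
      by (simp only: of_bool_conj)
  qed
  finally show ?thesis by (simp only: empty_time_prob_renewal)
qed

text \<open>
  The distribution of \<open>k_(i+1)\<close> is the convolution of that of \<open>k_i\<close> with the distribution of a return time,
  so its total mass is a product of total masses.
\<close>

lemma empty_time_prob_sums:
  assumes "(\<lambda>j. return_prob (Suc j)) sums 1"
  shows "empty_time_prob i sums 1"
proof (induction i)
  case 0
  have "empty_time_prob 0 k = (if k = 0 then 1 else 0)" for k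
    by (simp add: empty_time_prob_def zero_enat_def prob_space)
  then show ?case using sums_single[of 0 "\<lambda>_. 1::real"] by (simp add: fun_eq_iff cong: if_cong)
next
  case (Suc i)
  have nonneg: "0 \<le> empty_time_prob i k" "0 \<le> return_prob j" for k j
    by (simp_all add: empty_time_prob_def return_prob_def)
  have "empty_time_prob (Suc i) 0 = 0"
  proof -
    have "{\<omega> \<in> space M. empty_time (path \<omega>) (Suc i) = enat 0} = {}"
      by (auto elim: empty_time_Suc_finite simp del: empty_time.simps)
    then show ?thesis unfolding empty_time_prob_def by (simp only: measure_empty)
  qed
  moreover have "(\<lambda>k. empty_time_prob (Suc i) (Suc k)) sums (1 * 1)"
  proof -
    have "(\<lambda>k. \<Sum>m\<le>k. empty_time_prob i m * return_prob (Suc (k - m))) sums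
        ((\<Sum>k. empty_time_prob i k) * (\<Sum>j. return_prob (Suc j)))"
      using Suc assms nonneg by (intro Cauchy_product_sums) (auto simp: sums_iff)
    then show ?thesis
      using Suc assms by (simp add: empty_time_prob_Suc Suc_diff_le sums_iff cong: sum.cong_simp)
  qed
  ultimately show ?case using sums_Suc[of "empty_time_prob (Suc i)" 1] by simp
qed

text \<open>
  Summing over the value of \<open>k_i\<close> leaves \<open>return_prob j\<close> times the probability that \<open>k_i\<close> is finite. That
  probability is 1 by recurrence, unless \<open>return_prob j\<close> vanishes anyway.
\<close>

lemma empty_gap_prob:
  assumes "1 \<le> j"
  shows "\<P>(\<omega> in M. empty_gap (path \<omega>) i = enat j) = return_prob j"
proof -
  let ?A = "\<lambda>m. {\<omega> \<in> space M. empty_time (path \<omega>) i = enat m \<and>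
      first_return j (\<lambda>l. N (m + l) \<omega>)}"
  have "(\<lambda>m. prob (?A m)) sums prob (\<Union>m. ?A m)"
  proof (rule finite_measure_UNION)
    show "range ?A \<subseteq> events" using path_event[OF determined_by_renewal_event[OF order_refl]] by auto
    show "disjoint_family ?A" by (auto simp: disjoint_family_on_def)
  qed
  moreover have "(\<Union>m. ?A m) = {\<omega> \<in> space M. empty_gap (path \<omega>) i = enat j}"
  proof -
    have "empty_gap (path \<omega>) i = enat j \<longleftrightarrow> (\<exists>m. \<omega> \<in> ?A m)" if "\<omega> \<in> space M" for \<omega>
      using empty_gap_eq[of "path \<omega>" j i] N_init[OF that] that assms by simp
    then show ?thesis by blast
  qed
  moreover have "prob (?A m) = empty_time_prob i m * return_prob j" for m
    unfolding empty_time_prob_renewal[symmetric] of_bool_conj[symmetric]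
    by (rule path_mean_of_bool[symmetric]) (rule determined_by_renewal_event[OF order_refl])
  ultimately have sums: "(\<lambda>m. empty_time_prob i m * return_prob j) sums
      \<P>(\<omega> in M. empty_gap (path \<omega>) i = enat j)"
    by (simp only:)
  show ?thesis
  proof (cases "return_prob j = 0")
    case True
    then show ?thesis using sums_unique[OF sums] by simp
  next
    case False
    then have "0 < return_prob j" by (simp add: return_prob_def zero_less_measure_iff)
    then have "empty_time_prob i sums 1" by (intro empty_time_prob_sums recurrence)
    then have "(\<lambda>m. empty_time_prob i m * return_prob j) sums (1 * return_prob j)"
      by (rule sums_mult2)
    then show ?thesis using sums sums_unique2 by fastforce
  qed
qed

lemma Omega_sums:
  assumes "0 \<le> \<rho>" "\<rho> \<le> 1"
  shows "(\<lambda>j. \<alpha> * \<rho> ^ j * return_prob (Suc j)) sums Omega M N \<alpha> \<rho> i"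
proof -
  have "summable (\<lambda>j. return_prob (Suc j))" using return_prob_sums by (simp add: sums_iff)
  then have "summable (\<lambda>j. return_prob (Suc j) * \<rho> ^ j)"
    by (rule summable_comparison_test'[where N = 0])
      (use assms in \<open>auto simp: return_prob_nonneg power_le_one intro!: mult_left_le\<close>)
  then have sums: "(\<lambda>j. return_prob (Suc j) * \<rho> ^ j) sums (\<Sum>j. return_prob (Suc j) * \<rho> ^ j)"
    by (rule summable_sums)
  then have "((\<lambda>j. return_prob (Suc j) * \<rho> ^ j) has_sum (\<Sum>j. return_prob (Suc j) * \<rho> ^ j)) UNIV"
    by (rule sums_nonneg_imp_has_sum) (use assms in \<open>simp add: return_prob_nonneg\<close>)
  then have "(\<Sum>\<^sub>\<infinity>j. return_prob (Suc j) * \<rho> ^ j) = (\<Sum>j. return_prob (Suc j) * \<rho> ^ j)"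
    by (rule infsumI)
  moreover have "(\<Sum>\<^sub>\<infinity>j\<in>{1..}. \<P>(\<omega> in M. empty_gap (path \<omega>) i = enat j) * \<rho> ^ (j - 1))
      = (\<Sum>\<^sub>\<infinity>j\<in>{1..}. return_prob j * \<rho> ^ (j - 1))"
    by (rule infsum_cong) (simp add: empty_gap_prob)
  moreover have "{1..} = range Suc"
    by (auto simp: image_iff Suc_le_eq gr0_conv_Suc)
  ultimately have "Omega M N \<alpha> \<rho> i = \<alpha> * (\<Sum>j. return_prob (Suc j) * \<rho> ^ j)"
    unfolding Omega_def by (simp add: infsum_reindex o_def)
  then show ?thesis using sums_mult[OF sums, of \<alpha>] by (simp add: mult_ac)
qed

lemma mean_gain_sums:
  assumes \<alpha>: "0 \<le> \<alpha>" and \<rho>: "0 \<le> \<rho>" "\<rho> < 1" and less: "Omega M N \<alpha> \<rho> i < 1"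
  shows "(\<lambda>k. path_mean (\<lambda>n. gain \<alpha> \<rho> n k)) sums
    ((1 + \<alpha> - \<rho> - Omega M N \<alpha> \<rho> i) / ((1 - Omega M N \<alpha> \<rho> i) * (1 - \<rho>)))"
proof -
  define W where "W = Omega M N \<alpha> \<rho> i"
  define e where "e = (\<lambda>k. path_mean (\<lambda>n. gain \<alpha> \<rho> n k))"
  define a where "a = (\<lambda>k. path_mean (\<lambda>n. gain \<alpha> \<rho> n k * of_bool (eff_length n k = 0)))"
  have gain: "0 \<le> gain \<alpha> \<rho> n k" for n k using \<alpha> \<rho> by (intro gain_nonneg)
  have dgain: "determined_by k (\<lambda>n. gain \<alpha> \<rho> n k)" for k
    by (rule determined_by_gain) simp
  have da: "determined_by k (\<lambda>n. gain \<alpha> \<rho> n k * of_bool (eff_length n k = 0))" for k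
    by (rule determined_by_comp2[OF determined_by_gain[OF order_refl]
          determined_by_eff_length[OF order_refl], where g = "\<lambda>x y. x * of_bool (y = 0)"])
  have one: "path_mean (\<lambda>_. 1) = 1" by (simp add: path_mean_def prob_space)
  have a_nonneg: "0 \<le> a k" for k unfolding a_def using gain by (intro path_mean_nonneg) simp
  have a_rec: "a (Suc k) = (\<Sum>m\<le>k. a m * (\<alpha> * \<rho> ^ (k - m) * return_prob (Suc (k - m))))" for k
  proof -
    let ?f = "\<lambda>m n. gain \<alpha> \<rho> n m * of_bool (eff_length n m = 0)
        * of_bool (first_return (Suc k - m) (\<lambda>l. n (m + l)))"
    have "a (Suc k) = path_mean (\<lambda>n. \<Sum>m\<le>k. ?f m n * (\<alpha> * \<rho> ^ (k - m)))"
      unfolding a_def by (rule path_mean_cong) (rule gain_renewal, rule N_init)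
    also have "\<dots> = (\<Sum>m\<le>k. path_mean (\<lambda>n. ?f m n * (\<alpha> * \<rho> ^ (k - m))))"
    proof (rule path_mean_sum)
      fix m assume "m \<in> {..k}"
      then have "determined_by (Suc k) (\<lambda>n. gain \<alpha> \<rho> n m * of_bool (eff_length n m = 0))"
        "determined_by (Suc k) (\<lambda>n. first_return (Suc k - m) (\<lambda>l. n (m + l)))"
        by (auto intro: determined_by_mono[OF da] determined_by_shift[OF determined_by_first_return])
      then show "determined_by (Suc k) (\<lambda>n. ?f m n * (\<alpha> * \<rho> ^ (k - m)))"
        by (rule determined_by_comp2[where g = "\<lambda>x y. x * of_bool y * (\<alpha> * \<rho> ^ (k - m))"])
    qed
    also have "\<dots> = (\<Sum>m\<le>k. a m * return_prob (Suc k - m) * (\<alpha> * \<rho> ^ (k - m)))"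
    proof (rule sum.cong[OF refl])
      fix m
      have "path_mean (?f m) = a m * return_prob (Suc k - m)"
        unfolding a_def by (rule regeneration_return[OF da]) (metis mult_eq_0_iff of_bool_eq_0_iff)
      then show "path_mean (\<lambda>n. ?f m n * (\<alpha> * \<rho> ^ (k - m)))
          = a m * return_prob (Suc k - m) * (\<alpha> * \<rho> ^ (k - m))"
        by (simp only: path_mean_cmult)
    qed
    also have "\<dots> = (\<Sum>m\<le>k. a m * (\<alpha> * \<rho> ^ (k - m) * return_prob (Suc (k - m))))"
      by (rule sum.cong) (simp_all add: Suc_diff_le)
    finally show ?thesis .
  qed
  have "a 0 = path_mean (\<lambda>_. 1)"
    unfolding a_def by (rule path_mean_cong) (simp add: N_init eff_length_step_def)
  then have a0: "a 0 = 1" using one by simp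
  have "a sums (1 / (1 - W))"
  proof (rule renewal_equation_sums[OF a_nonneg _ _ _ a0 a_rec])
    show "(\<lambda>j. \<alpha> * \<rho> ^ j * return_prob (Suc j)) sums W"
      unfolding W_def using \<rho> by (intro Omega_sums) auto
  qed (use \<alpha> \<rho> less in \<open>auto simp: W_def return_prob_nonneg\<close>)
  moreover have "e (Suc k) = \<rho> * e k + (\<alpha> - \<rho>) * a k" for k
  proof -
    \<comment> \<open>The next factor is \<rho>, corrected by \<alpha> - \<rho> where the buffer is empty.\<close>
    have "e (Suc k) = path_mean (\<lambda>n. gain \<alpha> \<rho> n k * \<rho>
        - gain \<alpha> \<rho> n k * of_bool (eff_length n k = 0) * (\<rho> - \<alpha>))"
      unfolding e_def by (rule path_mean_cong) (simp add: gain_Suc algebra_simps)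
    also have "\<dots> = path_mean (\<lambda>n. gain \<alpha> \<rho> n k * \<rho>)
        - path_mean (\<lambda>n. gain \<alpha> \<rho> n k * of_bool (eff_length n k = 0) * (\<rho> - \<alpha>))"
      by (rule path_mean_diff) (rule determined_by_comp[OF dgain] determined_by_comp[OF da])+
    also have "\<dots> = e k * \<rho> - a k * (\<rho> - \<alpha>)"
      unfolding e_def a_def path_mean_cmult ..
    finally show ?thesis by (simp add: algebra_simps)
  qed
  moreover have "0 \<le> e k" for k unfolding e_def using gain by (intro path_mean_nonneg)
  moreover have "e 0 = 1" unfolding e_def by (simp add: one)
  ultimately have "e sums ((1 + (\<alpha> - \<rho>) * (1 / (1 - W))) / (1 - \<rho>))"
    using a_nonneg \<alpha> \<rho> by (intro affine_recursion_sums[of a]) auto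
  moreover have "(1 + (\<alpha> - \<rho>) * (1 / (1 - W))) / (1 - \<rho>) = (1 + \<alpha> - \<rho> - W) / ((1 - W) * (1 - \<rho>))"
    using less \<rho> by (simp add: W_def divide_simps)
  ultimately show ?thesis by (simp add: e_def W_def)
qed

end

section \<open>Stochastic stability\<close>

theorem theoremV3:
  fixes M :: "'w measure"
    and f :: "real ^ 'n \<Rightarrow> real ^ 'p \<Rightarrow> real ^ 'n"
    and \<kappa> :: "real ^ 'n \<Rightarrow> real ^ 'p"
    and V :: "real ^ 'n \<Rightarrow> real"
    and \<phi>1 \<phi>2 :: "real \<Rightarrow> real"
    and \<rho> \<alpha> :: real
    and \<Lambda> :: nat
    and Q :: "nat \<Rightarrow> nat \<Rightarrow> real"
    and N :: "nat \<Rightarrow> 'w \<Rightarrow> nat"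
    and x :: "nat \<Rightarrow> 'w \<Rightarrow> real ^ 'n"
    and u :: "nat \<Rightarrow> 'w \<Rightarrow> real ^ 'p"
    and i :: nat
  assumes prob: "prob_space M"
    and Lambda: "2 \<le> \<Lambda>"
    and f_zero: "f 0 0 = 0"
    \<comment> \<open>Plant controlled with the buffering algorithm\<close>
    and x_meas: "\<And>k. x k \<in> borel_measurable M"
    and plant: "\<And>k \<omega>. \<omega> \<in> space M \<Longrightarrow> x (Suc k) \<omega> = f (x k \<omega>) (u k \<omega>)"
    and input: "\<And>k \<omega>. \<omega> \<in> space M \<Longrightarrow>
                  u k \<omega> = buffer \<Lambda> f \<kappa> (\<lambda>m. N m \<omega>) (\<lambda>m. x m \<omega>) k 1"
    and x0_indep: "indep_of_process M (x 0) N"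
    \<comment> \<open>Assumption 1\<close>
    and V_nonneg: "\<And>z. 0 \<le> V z"
    and phi1: "class_K_infinity \<phi>1"
    and phi2: "class_K_infinity \<phi>2"
    and rho: "0 \<le> \<rho>" "\<rho> < 1"
    and V_bounds: "\<And>z. \<phi>1 (norm z) \<le> V z \<and> V z \<le> \<phi>2 (norm z)"
    and V_contract: "\<And>z. V (f z (\<kappa> z)) \<le> \<rho> * V z"
    \<comment> \<open>Assumption 2\<close>
    and markov: "homogeneous_markov_chain M {0..\<Lambda>} Q N"
    and N_init: "\<And>\<omega>. \<omega> \<in> space M \<Longrightarrow> N 0 \<omega> = 0"
    and irred: "irreducible_matrix {0..\<Lambda>} Q"
    and aper: "aperiodic_matrix {0..\<Lambda>} Q"
    \<comment> \<open>Assumption 3\<close>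
    and alpha: "0 \<le> \<alpha>"
    and V_open_loop: "\<And>z. V (f z 0) \<le> \<alpha> * V z"
    and moment: "expect_norm M \<phi>2 (x 0) < \<infinity>"
    and Omega_less: "Omega M N \<alpha> \<rho> i < 1"
  shows "stochastically_stable M x \<and>
         (\<Sum>k. expect_norm M \<phi>1 (x k))
           \<le> ennreal ((1 + \<alpha> - \<rho>) / ((1 - Omega M N \<alpha> \<rho> i) * (1 - \<rho>))) * expect_norm M \<phi>2 (x 0) \<and>
         (0 < Omega M N \<alpha> \<rho> i \<and> 0 < expect_norm M \<phi>2 (x 0) \<longrightarrow>
          (\<Sum>k. expect_norm M \<phi>1 (x k))
            < ennreal ((1 + \<alpha> - \<rho>) / ((1 - Omega M N \<alpha> \<rho> i) * (1 - \<rho>))) * expect_norm M \<phi>2 (x 0))"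
proof -
  interpret buffered_chain M \<Lambda> Q N
    using prob Lambda markov N_init irred
    by (intro buffered_chain.intro finite_markov_chain.intro finite_markov_chain_axioms.intro
        buffered_chain_axioms.intro) auto
  define W where "W = Omega M N \<alpha> \<rho> i"
  define e where "e = (\<lambda>k. path_mean (\<lambda>n. gain \<alpha> \<rho> n k))"
  define B where "B = (1 + \<alpha> - \<rho> - W) / ((1 - W) * (1 - \<rho>))"
  define I where "I = expect_norm M \<phi>2 (x 0)"
  have e_nonneg: "0 \<le> e k" for k
    unfolding e_def using alpha rho by (intro path_mean_nonneg gain_nonneg)
  have "continuous_on {0..} \<phi>2" using phi2 by (simp add: class_K_infinity_def)
  then have "continuous_on UNIV (\<lambda>z :: real ^ 'n. \<phi>2 (norm z))"
    by (rule continuous_on_compose2) (auto intro: continuous_on_norm_id)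
  then have "(\<lambda>z :: real ^ 'n. \<phi>2 (norm z)) \<in> borel_measurable borel"
    by (rule borel_measurable_continuous_onI)
  then have phi2_meas: "(\<lambda>z :: real ^ 'n. ennreal (\<phi>2 (norm z))) \<in> borel_measurable borel"
    by (rule measurable_compose) (rule measurable_ennreal)
  \<comment> \<open>Bounding V at time 0 by \<phi>2 before integrating avoids any measurability assumption on V.\<close>
  have step: "expect_norm M \<phi>1 (x k) \<le> ennreal (e k) * I" for k
  proof -
    have "expect_norm M \<phi>1 (x k)
        \<le> (\<integral>\<^sup>+ \<omega>. ennreal (gain \<alpha> \<rho> (path \<omega>) k) * ennreal (\<phi>2 (norm (x 0 \<omega>))) \<partial>M)"
      unfolding expect_norm_def
    proof (rule nn_integral_mono)
      fix \<omega> assume \<omega>: "\<omega> \<in> space M"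
      have gain: "0 \<le> gain \<alpha> \<rho> (path \<omega>) k" using alpha rho by (intro gain_nonneg)
      have "\<phi>1 (norm (x k \<omega>)) \<le> V (x k \<omega>)" using V_bounds by blast
      also have "\<dots> \<le> gain \<alpha> \<rho> (path \<omega>) k * V (x 0 \<omega>)"
        using plant[OF \<omega>] input[OF \<omega>] N_le[OF \<omega>] Lambda V_contract V_open_loop alpha rho
        by (intro lyapunov_gain[where x = "\<lambda>m. x m \<omega>" and f = f and L = \<Lambda> and \<kappa> = \<kappa>]) auto
      also have "\<dots> \<le> gain \<alpha> \<rho> (path \<omega>) k * \<phi>2 (norm (x 0 \<omega>))"
        using V_bounds gain by (intro mult_left_mono) auto
      finally show "ennreal (\<phi>1 (norm (x k \<omega>)))
          \<le> ennreal (gain \<alpha> \<rho> (path \<omega>) k) * ennreal (\<phi>2 (norm (x 0 \<omega>)))"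
        using gain by (simp add: ennreal_mult'[symmetric] ennreal_leI)
    qed
    also have "\<dots> = ennreal (e k) * I"
      unfolding e_def I_def expect_norm_def
      using alpha rho
      by (intro nn_integral_indep_process[OF x0_indep x_meas phi2_meas
            determined_by_gain[OF order_refl]] gain_nonneg)
    finally show ?thesis .
  qed
  have "e sums B"
    unfolding e_def B_def W_def using alpha rho Omega_less by (rule mean_gain_sums)
  then have "(\<Sum>k. ennreal (e k)) = ennreal B"
    by (rule suminf_ennreal_eq[OF e_nonneg])
  then have "(\<Sum>k. ennreal (e k) * I) = ennreal B * I"
    by (simp only: ennreal_suminf_multc)
  moreover have "(\<Sum>k. expect_norm M \<phi>1 (x k)) \<le> (\<Sum>k. ennreal (e k) * I)"
    by (rule suminf_le[OF step]) auto
  ultimately have total: "(\<Sum>k. expect_norm M \<phi>1 (x k)) \<le> ennreal B * I" by simp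
  have W: "0 \<le> W" "W < 1"
    using sums_le[OF _ sums_zero Omega_sums[of \<rho> \<alpha> i]] alpha rho return_prob_nonneg Omega_less
    by (auto simp: W_def)
  have B: "B \<le> (1 + \<alpha> - \<rho>) / ((1 - W) * (1 - \<rho>))"
    unfolding B_def using W rho by (intro divide_right_mono) auto
  have "ennreal B * I < \<infinity>" using moment by (simp add: I_def ennreal_mult_less_top)
  then have "stochastically_stable M x"
    unfolding stochastically_stable_def using phi1 total order_le_less_trans by blast
  moreover have "(\<Sum>k. expect_norm M \<phi>1 (x k)) \<le> ennreal ((1 + \<alpha> - \<rho>) / ((1 - W) * (1 - \<rho>))) * I"
    using total by (rule order_trans) (intro mult_right_mono ennreal_leI B, simp)
  moreover have "(\<Sum>k. expect_norm M \<phi>1 (x k)) < ennreal ((1 + \<alpha> - \<rho>) / ((1 - W) * (1 - \<rho>))) * I"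
    if "0 < W" "0 < I"
  proof -
    have "0 \<le> B" using \<open>e sums B\<close> e_nonneg sums_le[OF _ sums_zero] by blast
    moreover have "B < (1 + \<alpha> - \<rho>) / ((1 - W) * (1 - \<rho>))"
      unfolding B_def using that W rho by (intro divide_strict_right_mono) auto
    ultimately have "ennreal B < ennreal ((1 + \<alpha> - \<rho>) / ((1 - W) * (1 - \<rho>)))"
      by (simp add: ennreal_less_iff)
    then have "ennreal B * I < ennreal ((1 + \<alpha> - \<rho>) / ((1 - W) * (1 - \<rho>))) * I"
      using that moment by (intro ennreal_mult_strict_right_mono) (auto simp: I_def)
    with total show ?thesis by (rule order_le_less_trans)
  qed
  ultimately show ?thesis by (simp add: W_def I_def)
qed

end
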